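(* Let $T,M\in\mathbb N$ be fixed, and let $(\epsilon_n)$ with $\epsilon_n\in(0,1)$ and $(\gamma_n)$ with $\gamma_n>0$ be sequences with $\epsilon_n=o(1)$ and $n\epsilon_n=\omega(1)$. Let $P_{NA}(n)=\max_{\{p_i\}:\ p_i\ge\gamma_n\ \forall i}P(\widehat{\mathcal U}^{NA}\cap\mathcal H_1\ne\emptyset)$ be the worst-case error probability of the non-adaptive robust detector (defined in the context) with $M$ measurements per channel for identifying $T$ spectrum holes. Then $P_{NA}(n)\to0$ as $n\to\infty$ if and only if $$\gamma_n=\omega\left(\sqrt[M]{\frac1{\epsilon_n}}\right).$$
   Context: Asymptotic notation, for positive sequences as $n\to\infty$: $a_n=\omega(b_n)$ means $\liminf a_n/b_n=\infty$; $a_n=o(b_n)$ means $\limsup a_n/b_n=0$. Model. There are $n$ channels. The occupancy variables $Z_1,\dots,Z_n$ are i.i.d. Bernoulli with $P(Z_i=0)=\epsilon_n$, $P(Z_i=1)=1-\epsilon_n$. $\mathcal H_0=\{i:Z_i=0\}$ is the set of spectrum holes, $\mathcal H_1=\{i:Z_i=1\}$ the set of occupied channels. A user active on channel $i$ has (deterministic) received power $p_i\ge\gamma_n$. Each measurement of channel $i$ is, conditionally on $Z_i$, a circularly symmetric complex Gaussian variable with mean $0$ and variance $1+p_iZ_i$; conditionally on $(Z_i)_i$ all measurements (over channels and over time) are independent. The $Z_i$ and $p_i$ do not change during sensing. Non-adaptive robust detector. Take $M$ measurements of every channel, let $Y_i$ be the sum of squared moduli of those of channel $i$, and output $\widehat{\mathcal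 U}^{NA}=\{i: Y_i\le Y_{(T)}\}$, where $Y_{(T)}$ is the $T$-th smallest of $Y_1,\dots,Y_n$. *)

theory Defs
  imports "HOL-Probability.Probability" "HOL-Library.Landau_Symbols"
begin

text \<open>
  Circularly symmetric complex Gaussian law with mean 0 and variance \<open>v\<close>: real and imaginary
  parts are independent real Gaussians of variance \<open>v / 2\<close> each.
  (\<^const>\<open>normal_density\<close> is parametrised by the standard deviation.)
\<close>

definition complex_gaussian :: "real \<Rightarrow> complex measure" where
  "complex_gaussian v =
     (let N = density lborel (\<lambda>x. ennreal (normal_density 0 (sqrt (v / 2)) x))
      in distr (N \<Otimes>\<^sub>M N) borel (\<lambda>(a, b). Complex a b))"

text \<open>
  Occupancies are Boolean: \<open>z i\<close> stands for $Z_i = 1$ (channel \<open>i\<close> occupied) and \<open>\<not> z i\<close> for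
  $Z_i = 0$ (spectrum hole). Outside the channel set \<open>{1..n}\<close> the configuration is \<open>False\<close>.
\<close>

definition occupancy_pmf :: "nat \<Rightarrow> real \<Rightarrow> (nat \<Rightarrow> bool) pmf" where
  "occupancy_pmf n e = Pi_pmf {1..n} False (\<lambda>_. bernoulli_pmf (1 - e))"

definition measurement_law ::
    "nat \<Rightarrow> nat \<Rightarrow> (nat \<Rightarrow> real) \<Rightarrow> (nat \<Rightarrow> bool) \<Rightarrow> (nat \<times> nat \<Rightarrow> complex) measure" where
  "measurement_law n M p z =
     (\<Pi>\<^sub>M (i, t)\<in>{1..n} \<times> {1..M}. complex_gaussian (1 + p i * of_bool (z i)))"

text \<open>
  Joint law of the occupancies and all measurements: draw \<open>z\<close>, then draw the measurements from
  their conditional law given \<open>z\<close>. In an outcome \<open>(z, x)\<close>, \<open>x (i, t)\<close> is the \<open>t\<close>-th measurement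
  of channel \<open>i\<close>.
\<close>

definition sensing_law ::
    "nat \<Rightarrow> nat \<Rightarrow> real \<Rightarrow> (nat \<Rightarrow> real) \<Rightarrow> ((nat \<Rightarrow> bool) \<times> (nat \<times> nat \<Rightarrow> complex)) measure" where
  "sensing_law n M e p =
     measure_pmf (occupancy_pmf n e) \<bind> (\<lambda>z.
       distr (measurement_law n M p z)
             (count_space UNIV \<Otimes>\<^sub>M (\<Pi>\<^sub>M _\<in>{1..n} \<times> {1..M}. borel))
             (\<lambda>x. (z, x)))"

definition energy :: "nat \<Rightarrow> (nat \<times> nat \<Rightarrow> complex) \<Rightarrow> nat \<Rightarrow> real" where
  "energy M x i = (\<Sum>t = 1..M. (cmod (x (i, t)))\<^sup>2)"

text \<open>
  \<open>T\<close>-th smallest (\<open>1 \<le> T \<le> n\<close>) of the values \<open>y 1, \<dots>, y n\<close>, counted with multiplicity;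
  unspecified if \<open>n < T\<close>.
\<close>

definition order_statistic :: "nat \<Rightarrow> nat \<Rightarrow> (nat \<Rightarrow> real) \<Rightarrow> real" where
  "order_statistic n T y = sort (map y [1..<Suc n]) ! (T - 1)"

definition detected :: "nat \<Rightarrow> nat \<Rightarrow> nat \<Rightarrow> (nat \<times> nat \<Rightarrow> complex) \<Rightarrow> nat set" where
  "detected n T M x = {i \<in> {1..n}. energy M x i \<le> order_statistic n T (energy M x)}"

definition occupied :: "nat \<Rightarrow> (nat \<Rightarrow> bool) \<Rightarrow> nat set" where
  "occupied n z = {i \<in> {1..n}. z i}"

definition error_prob :: "nat \<Rightarrow> nat \<Rightarrow> nat \<Rightarrow> real \<Rightarrow> (nat \<Rightarrow> real) \<Rightarrow> real" where
  "error_prob n T M e p =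
     measure (sensing_law n M e p)
       {(z, x) \<in> space (sensing_law n M e p). detected n T M x \<inter> occupied n z \<noteq> {}}"

text \<open>
  Worst case over all admissible powers. The family of probabilities is nonempty and bounded
  by 1, so the real supremum is meaningful, and it equals the maximum whenever that is attained.
\<close>

definition P_NA :: "nat \<Rightarrow> nat \<Rightarrow> nat \<Rightarrow> real \<Rightarrow> real \<Rightarrow> real" where
  "P_NA n T M e g = (SUP p \<in> {p. \<forall>i\<in>{1..n}. g \<le> p i}. error_prob n T M e p)"

lemma sets_complex_gaussian [simp, measurable_cong]: "sets (complex_gaussian v) = sets borel"
  by (simp add: complex_gaussian_def Let_def)

lemma prob_space_complex_gaussian:
  assumes "v > 0"
  shows "prob_space (complex_gaussian v)"
proof -
  let ?N = "density lborel (\<lambda>x. ennreal (normal_density 0 (sqrt (v / 2)) x))"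
  interpret N: prob_space ?N
    using assms by (intro prob_space_normal_density) simp
  interpret NN: pair_prob_space ?N ?N ..
  have "(\<lambda>(a, b). Complex a b) \<in> borel_measurable (?N \<Otimes>\<^sub>M ?N)"
    unfolding Complex_eq case_prod_beta by measurable
  then show ?thesis
    unfolding complex_gaussian_def Let_def by (rule NN.prob_space_distr)
qed

lemma prob_space_measurement_law:
  assumes "\<And>i. i \<in> {1..n} \<Longrightarrow> p i > 0"
  shows "prob_space (measurement_law n M p z)"
  unfolding measurement_law_def
proof (intro prob_space_PiM)
  fix k assume k: "k \<in> {1..n} \<times> {1..M}"
  obtain i t where kk: "k = (i, t)" by (cases k)
  with k assms[of i] have "p i > 0" by auto
  then show "prob_space (case k of (i, t) \<Rightarrow> complex_gaussian (1 + p i * of_bool (z i)))"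
    unfolding kk by (auto intro!: prob_space_complex_gaussian)
qed

lemma sets_measurement_law:
  "sets (measurement_law n M p z) = sets (\<Pi>\<^sub>M _\<in>{1..n} \<times> {1..M}. borel)"
  unfolding measurement_law_def by (intro sets_PiM_cong) auto

lemma prob_space_sensing_law:
  assumes "\<And>i. i \<in> {1..n} \<Longrightarrow> p i > 0"
  shows "prob_space (sensing_law n M e p)"
proof -
  let ?S = "count_space UNIV \<Otimes>\<^sub>M (\<Pi>\<^sub>M _\<in>{1..n} \<times> {1..M}. borel)
    :: ((nat \<Rightarrow> bool) \<times> (nat \<times> nat \<Rightarrow> complex)) measure"
  have m: "(\<lambda>x. (z, x)) \<in> measurable (measurement_law n M p z) ?S" for z
    using measurable_Pair1'[of z "count_space UNIV" "\<Pi>\<^sub>M _\<in>{1..n} \<times> {1..M}. borel"]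
    by (simp add: measurable_cong_sets[OF sets_measurement_law refl])
  have P: "prob_space (distr (measurement_law n M p z) ?S (\<lambda>x. (z, x)))" for z
    by (intro prob_space.prob_space_distr prob_space_measurement_law m assms)
  show ?thesis
    unfolding sensing_law_def
  proof (rule prob_space.prob_space_bind)
    show "prob_space (measure_pmf (occupancy_pmf n e))" by unfold_locales
    show "AE z in measure_pmf (occupancy_pmf n e).
        prob_space (distr (measurement_law n M p z) ?S (\<lambda>x. (z, x)))"
      using P by simp
    show "(\<lambda>z. distr (measurement_law n M p z) ?S (\<lambda>x. (z, x)))
        \<in> measurable (measure_pmf (occupancy_pmf n e)) (subprob_algebra ?S)"
      using P by (auto simp: space_subprob_algebra intro: prob_space_imp_subprob_space)
  qed
qed

end

theory Submission
  imports Defs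
begin

text \<open>
  The energy of a channel of variance \<open>v\<close> is at most \<open>\<tau>\<close> with probability of order
  \<open>(\<tau> / v) ^ M\<close>; comparing with boxes, i.e. with bounds on the individual measurements, gives this
  without the Gamma law. Call a channel quiet if its energy is at most \<open>\<tau>\<close>.

  If at least \<open>T\<close> holes and no occupied channel are quiet, the detector makes no error. With
  \<open>n * \<tau> ^ M = s\<close>, the number of quiet holes has mean of order \<open>\<epsilon> * s\<close> and the expected number
  of quiet occupied channels is of order at most \<open>s / \<gamma> ^ M\<close>. If \<open>\<gamma> ^ M * \<epsilon>\<close> tends to infinity,
  \<open>s = min n (sqrt (\<gamma> ^ M / \<epsilon>))\<close> sends the first to infinity and the second to 0.

  Conversely, if some channel but no hole is quiet, the channel of least energy is occupied and
  detected. Take all powers equal to \<open>\<gamma>\<close> and \<open>\<tau> ^ M = 1 / (n * \<epsilon>)\<close>: a channel is a quiet hole with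
  probability \<open>O(1 / n)\<close>, and quiet and occupied with probability at least of order \<open>1 / n\<close> as long
  as \<open>\<gamma> ^ M * \<epsilon>\<close> stays bounded, so the error probability stays away from 0.
\<close>

subsection \<open>Independence of the channels\<close>

text \<open>The joint law of the coordinates is \<open>PiM I N\<close> itself, and each factor
  \<open>N i\<close> is the law of the corresponding coordinate. So the joint law is the product of
  the marginals, which characterises independence.\<close>

lemma indep_vars_PiM_coordinates:
  assumes "I \<noteq> {}" and "\<And>i. i \<in> I \<Longrightarrow> prob_space (N i)"
  shows "prob_space.indep_vars (PiM I N) N (\<lambda>i x. x i) I"
proof -
  interpret P: prob_space "PiM I N"
    using assms by (intro prob_space_PiM)
  have "distr (PiM I N) (PiM I N) (\<lambda>x. \<lambda>i\<in>I. x i) = distr (PiM I N) (PiM I N) (\<lambda>x. x)"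
    by (intro distr_cong) (auto simp: space_PiM PiE_def extensional_restrict)
  also have "\<dots> = PiM I N"
    by simp
  also have "\<dots> = (\<Pi>\<^sub>M i\<in>I. distr (PiM I N) (N i) (\<lambda>x. x i))"
    using assms by (intro PiM_cong refl distr_PiM_component[symmetric]) auto
  finally show ?thesis
    using assms by (subst P.indep_vars_iff_distr_eq_PiM') auto
qed

text \<open>For \<open>v > 0\<close> and \<open>M \<ge> 1\<close> this is the Gamma law of shape
  \<open>M\<close> and scale \<open>v\<close>. Only the order of its distribution function near 0
  matters below, so it is kept as an image measure.\<close>

definition energy_law :: "nat \<Rightarrow> real \<Rightarrow> real measure" where
  "energy_law M v =
     distr (\<Pi>\<^sub>M _\<in>{1..M}. complex_gaussian v) borel (\<lambda>y. \<Sum>t = 1..M. (cmod (y t))\<^sup>2)"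

lemma sets_energy_law [simp, measurable_cong]: "sets (energy_law M v) = sets borel"
  by (simp add: energy_law_def)

lemma space_energy_law [simp]: "space (energy_law M v) = UNIV"
  by (simp add: energy_law_def)

lemma measurable_total_energy:
  "(\<lambda>y. \<Sum>t = 1..M. (cmod (y t))\<^sup>2) \<in> borel_measurable (\<Pi>\<^sub>M _\<in>{1..M}. complex_gaussian v)"
  by (intro borel_measurable_sum borel_measurable_power borel_measurable_norm)
     (auto intro!: measurable_component_singleton simp: measurable_cong_sets[OF refl sets_complex_gaussian[symmetric]])

lemma prob_space_energy_law:
  assumes "v > 0"
  shows "prob_space (energy_law M v)"
  unfolding energy_law_def
  by (intro prob_space.prob_space_distr prob_space_PiM prob_space_complex_gaussian
      measurable_total_energy assms)

lemma measurable_energy: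
  assumes "i \<in> {1..n}"
  shows "(\<lambda>x. energy M x i) \<in> borel_measurable (\<Pi>\<^sub>M _\<in>{1..n} \<times> {1..M}. borel)"
  unfolding energy_def using assms
  by (intro borel_measurable_sum borel_measurable_power borel_measurable_norm
      measurable_component_singleton) auto

text \<open>The energy of channel \<open>i\<close> sees only row \<open>i\<close> of the
  measurements, and the marginal of the product measure on that row is a product of \<open>M\<close>
  equal Gaussian laws.\<close>

lemma distr_energy:
  assumes "\<And>i. i \<in> {1..n} \<Longrightarrow> p i > 0" and i: "i \<in> {1..n}"
  shows "distr (measurement_law n M p z) borel (\<lambda>x. energy M x i)
       = energy_law M (1 + p i * of_bool (z i))"
proof -
  let ?N = "\<lambda>(i, t :: nat). complex_gaussian (1 + p i * of_bool (z i))"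
  let ?v = "1 + p i * of_bool (z i)"
  let ?r = "\<lambda>x. \<lambda>t\<in>{1..M}. x (i, t)"
  have ps: "prob_space (?N k)" if "k \<in> {1..n} \<times> {1..M}" for k
    using that assms(1) by (cases k) (auto intro!: prob_space_complex_gaussian add_pos_nonneg
        simp: less_imp_le)
  \<comment> \<open>The map sending \<open>t\<close> to \<open>(i, t)\<close> is injective, so
    reindexing along it gives the marginal on row \<open>i\<close>.\<close>
  have "distr (PiM ({1..n} \<times> {1..M}) ?N) (\<Pi>\<^sub>M t\<in>{1..M}. ?N (i, t)) ?r = (\<Pi>\<^sub>M t\<in>{1..M}. ?N (i, t))"
    using i by (intro distr_PiM_reindex ps) (auto simp: inj_on_def)
  then have r: "distr (measurement_law n M p z) (\<Pi>\<^sub>M t\<in>{1..M}. complex_gaussian ?v) ?r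
      = (\<Pi>\<^sub>M t\<in>{1..M}. complex_gaussian ?v)"
    by (simp add: measurement_law_def)
  have rm: "?r \<in> measurable (measurement_law n M p z) (\<Pi>\<^sub>M t\<in>{1..M}. complex_gaussian ?v)"
    using i by (intro measurable_restrict)
      (auto simp: measurable_cong_sets[OF sets_measurement_law sets_complex_gaussian]
        intro!: measurable_component_singleton)
  have "energy_law M ?v = distr (distr (measurement_law n M p z) (\<Pi>\<^sub>M t\<in>{1..M}. complex_gaussian ?v) ?r)
      borel (\<lambda>y. \<Sum>t = 1..M. (cmod (y t))\<^sup>2)"
    by (simp only: energy_law_def r)
  also have "\<dots> = distr (measurement_law n M p z) borel
      ((\<lambda>y. \<Sum>t = 1..M. (cmod (y t))\<^sup>2) \<circ> ?r)"
    by (rule distr_distr[OF measurable_total_energy rm])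
  also have "\<dots> = distr (measurement_law n M p z) borel (\<lambda>x. energy M x i)"
    by (intro distr_cong) (auto simp: energy_def)
  finally show ?thesis by simp
qed

text \<open>The energies are functions of disjoint blocks of independent coordinates, one block
  \<open>{i} \<times> {1..M}\<close> per channel.\<close>

lemma indep_vars_energy:
  assumes "\<And>i. i \<in> {1..n} \<Longrightarrow> p i > 0" and "n \<ge> 1" and "M \<ge> 1"
  shows "prob_space.indep_vars (measurement_law n M p z) (\<lambda>_. borel) (\<lambda>i x. energy M x i) {1..n}"
proof -
  let ?N = "\<lambda>(i, t :: nat). complex_gaussian (1 + p i * of_bool (z i))"
  let ?I = "{1..n} \<times> {1..M}"
  interpret P: prob_space "measurement_law n M p z"
    by (rule prob_space_measurement_law[OF assms(1)])
  have ps: "prob_space (?N k)" if "k \<in> ?I" for k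
    using that assms(1) by (cases k) (auto intro!: prob_space_complex_gaussian add_pos_nonneg
        simp: less_imp_le)
  have "P.indep_vars ?N (\<lambda>k x. x k) ?I"
    unfolding measurement_law_def using assms ps by (intro indep_vars_PiM_coordinates) auto
  then have "P.indep_vars (\<lambda>i. PiM ({i} \<times> {1..M}) ?N)
      (\<lambda>i x. restrict (\<lambda>k. x k) ({i} \<times> {1..M})) {1..n}"
    by (rule P.indep_vars_restrict) (auto simp: disjoint_family_on_def)
  then have "P.indep_vars (\<lambda>_. borel)
      (\<lambda>i x. (\<lambda>y. \<Sum>t = 1..M. (cmod (y (i, t)))\<^sup>2) (restrict (\<lambda>k. x k) ({i} \<times> {1..M}))) {1..n}"
  proof (rule P.indep_vars_compose2)
    fix i assume "i \<in> {1..n}"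
    have "(\<lambda>y. y (i, t)) \<in> borel_measurable (PiM ({i} \<times> {1..M}) ?N)" if "t \<in> {1..M}" for t
      using that measurable_component_singleton[of "(i, t)" "{i} \<times> {1..M}" ?N]
      by (simp add: measurable_cong_sets[OF refl sets_complex_gaussian])
    then show "(\<lambda>y. \<Sum>t = 1..M. (cmod (y (i, t)))\<^sup>2) \<in> borel_measurable (PiM ({i} \<times> {1..M}) ?N)"
      by (intro borel_measurable_sum borel_measurable_power measurable_compose[OF _ borel_measurable_norm])
  qed
  also have "(\<lambda>i x. (\<lambda>y. \<Sum>t = 1..M. (cmod (y (i, t)))\<^sup>2) (restrict (\<lambda>k. x k) ({i} \<times> {1..M})))
      = (\<lambda>i x. energy M x i)"
    by (auto simp: energy_def fun_eq_iff intro!: sum.cong)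
  finally show ?thesis .
qed

lemma nn_integral_prod_energy:
  assumes "\<And>i. i \<in> {1..n} \<Longrightarrow> p i > 0" and "n \<ge> 1" and "M \<ge> 1"
    and f: "\<And>i. i \<in> {1..n} \<Longrightarrow> f i \<in> borel_measurable borel"
  shows "(\<integral>\<^sup>+x. (\<Prod>i\<in>{1..n}. f i (energy M x i)) \<partial>measurement_law n M p z)
       = (\<Prod>i\<in>{1..n}. \<integral>\<^sup>+y. f i y \<partial>energy_law M (1 + p i * of_bool (z i)))"
proof -
  interpret P: prob_space "measurement_law n M p z"
    by (rule prob_space_measurement_law[OF assms(1)])
  have "P.indep_vars (\<lambda>_. borel) (\<lambda>i x. f i (energy M x i)) {1..n}"
    using f by (intro P.indep_vars_compose2[OF indep_vars_energy] assms)
  then have "(\<integral>\<^sup>+x. (\<Prod>i\<in>{1..n}. f i (energy M x i)) \<partial>measurement_law n M p z)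
      = (\<Prod>i\<in>{1..n}. \<integral>\<^sup>+x. f i (energy M x i) \<partial>measurement_law n M p z)"
    by (intro P.indep_vars_nn_integral) auto
  also have "\<dots> = (\<Prod>i\<in>{1..n}. \<integral>\<^sup>+y. f i y \<partial>energy_law M (1 + p i * of_bool (z i)))"
  proof (rule prod.cong[OF refl])
    fix i assume i: "i \<in> {1..n}"
    have "energy_law M (1 + p i * of_bool (z i))
        = distr (measurement_law n M p z) borel (\<lambda>x. energy M x i)"
      by (rule distr_energy[symmetric]) (use assms(1) i in auto)
    then show "(\<integral>\<^sup>+x. f i (energy M x i) \<partial>measurement_law n M p z)
        = (\<integral>\<^sup>+y. f i y \<partial>energy_law M (1 + p i * of_bool (z i)))"
      using measurable_energy[OF i, of M] f[OF i]
      by (simp add: nn_integral_distr measurable_cong_sets[OF sets_measurement_law refl])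
  qed
  finally show ?thesis .
qed

section \<open>Integration under the joint law of occupancies and measurements\<close>

abbreviation sensing_space :: "nat \<Rightarrow> nat \<Rightarrow> ((nat \<Rightarrow> bool) \<times> (nat \<times> nat \<Rightarrow> complex)) measure" where
  "sensing_space n M \<equiv> count_space UNIV \<Otimes>\<^sub>M (\<Pi>\<^sub>M _\<in>{1..n} \<times> {1..M}. borel)"

lemma measurable_Pair_measurement:
  "Pair z \<in> measurable (measurement_law n M p z) (sensing_space n M)"
  using measurable_Pair1'[of z "count_space UNIV" "\<Pi>\<^sub>M _\<in>{1..n} \<times> {1..M}. borel"]
  by (simp add: measurable_cong_sets[OF sets_measurement_law refl])

lemma measurable_sensing_kernel:
  assumes "\<And>i. i \<in> {1..n} \<Longrightarrow> p i > 0"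
  shows "(\<lambda>z. distr (measurement_law n M p z) (sensing_space n M) (\<lambda>x. (z, x)))
    \<in> measurable (measure_pmf (occupancy_pmf n e)) (subprob_algebra (sensing_space n M))"
proof -
  have "prob_space (distr (measurement_law n M p z) (sensing_space n M) (\<lambda>x. (z, x)))" for z
    by (intro prob_space.prob_space_distr prob_space_measurement_law measurable_Pair_measurement assms)
  then show ?thesis
    by (auto simp: space_subprob_algebra intro: prob_space_imp_subprob_space)
qed

lemma sets_sensing_law:
  assumes "\<And>i. i \<in> {1..n} \<Longrightarrow> p i > 0"
  shows "sets (sensing_law n M e p) = sets (sensing_space n M)"
  unfolding sensing_law_def
  by (rule sets_bind[OF sets_kernel[OF measurable_sensing_kernel[OF assms]]]) auto

lemma measurable_energy_snd:
  assumes "i \<in> {1..n}"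
  shows "(\<lambda>w. energy M (snd w) i) \<in> borel_measurable (sensing_space n M)"
  using measurable_compose[OF measurable_snd measurable_energy[OF assms]] .

text \<open>The occupancy takes two values on a discrete space, so a function of occupancy and
  energy is a case distinction between two measurable functions of the energy alone.\<close>

lemma measurable_occupancy_energy:
  assumes "i \<in> {1..n}" and f: "\<And>b. f b \<in> measurable borel N"
  shows "(\<lambda>w. f (fst w i) (energy M (snd w) i)) \<in> measurable (sensing_space n M) N"
proof -
  have 1: "(\<lambda>w. f b (energy M (snd w) i)) \<in> measurable (sensing_space n M) N" for b
    using measurable_compose[OF measurable_energy_snd[OF assms(1)] f] .
  have 2: "Measurable.pred (sensing_space n M) (\<lambda>w. fst w i)"
    by (rule measurable_compose[OF measurable_fst]) simp
  have "(\<lambda>w. if fst w i then f True (energy M (snd w) i) else f False (energy M (snd w) i))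
      \<in> measurable (sensing_space n M) N"
    by (rule measurable_If[OF 1 1 2[unfolded pred_def]])
  also have "(\<lambda>w. if fst w i then f True (energy M (snd w) i) else f False (energy M (snd w) i))
      = (\<lambda>w. f (fst w i) (energy M (snd w) i))"
  proof (rule ext)
    fix w :: "(nat \<Rightarrow> bool) \<times> (nat \<times> nat \<Rightarrow> complex)"
    show "(if fst w i then f True (energy M (snd w) i) else f False (energy M (snd w) i))
        = f (fst w i) (energy M (snd w) i)"
      by (cases "fst w i") simp_all
  qed
  finally show ?thesis .
qed

text \<open>Independence is used twice: given \<open>z\<close> the energies are independent, and
  then the occupancies are independent under \<open>occupancy_pmf\<close>. What remains is one
  Bernoulli average per channel. The probability bounds below all come from a choice of
  \<open>f\<close>, an indicator or a weight.\<close>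

lemma nn_integral_prod_sensing_law:
  assumes p: "\<And>i. i \<in> {1..n} \<Longrightarrow> p i > 0" and "n \<ge> 1" and "M \<ge> 1" and e: "0 \<le> e" "e \<le> 1"
    and f: "\<And>i b. i \<in> {1..n} \<Longrightarrow> f i b \<in> borel_measurable borel"
  shows "(\<integral>\<^sup>+w. (\<Prod>i\<in>{1..n}. f i (fst w i) (energy M (snd w) i)) \<partial>sensing_law n M e p)
       = (\<Prod>i\<in>{1..n}. (\<integral>\<^sup>+y. f i False y \<partial>energy_law M 1) * ennreal e
           + (\<integral>\<^sup>+y. f i True y \<partial>energy_law M (1 + p i)) * ennreal (1 - e))"
proof -
  have fm: "(\<lambda>w. \<Prod>i\<in>{1..n}. f i (fst w i) (energy M (snd w) i)) \<in> borel_measurable (sensing_space n M)"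
    using f by (intro borel_measurable_prod_ennreal measurable_occupancy_energy) auto
  have km: "(\<lambda>z. distr (measurement_law n M p z) (sensing_space n M) (\<lambda>x. (z, x)))
      \<in> measurable (measure_pmf (occupancy_pmf n e)) (subprob_algebra (sensing_space n M))"
    by (rule measurable_sensing_kernel[OF p])
  have "(\<integral>\<^sup>+w. (\<Prod>i\<in>{1..n}. f i (fst w i) (energy M (snd w) i)) \<partial>sensing_law n M e p)
      = (\<integral>\<^sup>+z. \<integral>\<^sup>+x. (\<Prod>i\<in>{1..n}. f i (z i) (energy M x i)) \<partial>measurement_law n M p z
          \<partial>measure_pmf (occupancy_pmf n e))"
    unfolding sensing_law_def nn_integral_bind[OF fm km]
  proof (rule nn_integral_cong)
    fix z
    show "(\<integral>\<^sup>+w. (\<Prod>i\<in>{1..n}. f i (fst w i) (energy M (snd w) i))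
          \<partial>distr (measurement_law n M p z) (sensing_space n M) (Pair z))
        = (\<integral>\<^sup>+x. (\<Prod>i\<in>{1..n}. f i (z i) (energy M x i)) \<partial>measurement_law n M p z)"
      by (subst nn_integral_distr[OF measurable_Pair_measurement]) (use fm in simp_all)
  qed
  also have "\<dots> = (\<integral>\<^sup>+z. (\<Prod>i\<in>{1..n}. \<integral>\<^sup>+y. f i (z i) y \<partial>energy_law M (1 + p i * of_bool (z i)))
          \<partial>measure_pmf (occupancy_pmf n e))"
    using assms by (intro nn_integral_cong nn_integral_prod_energy) auto
  also have "\<dots> = (\<Prod>i\<in>{1..n}. \<integral>\<^sup>+b. \<integral>\<^sup>+y. f i b y \<partial>energy_law M (1 + p i * of_bool b)
          \<partial>measure_pmf (bernoulli_pmf (1 - e)))"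
    unfolding occupancy_pmf_def
    by (rule nn_integral_prod_Pi_pmf[where f = "\<lambda>i b. \<integral>\<^sup>+y. f i b y \<partial>energy_law M (1 + p i * of_bool b)"]) simp
  also have "\<dots> = (\<Prod>i\<in>{1..n}. (\<integral>\<^sup>+y. f i False y \<partial>energy_law M 1) * ennreal e
           + (\<integral>\<^sup>+y. f i True y \<partial>energy_law M (1 + p i)) * ennreal (1 - e))"
    using e by (intro prod.cong) (auto simp: add.commute)
  finally show ?thesis .
qed

subsection \<open>Small energies\<close>

lemma space_complex_gaussian [simp]: "space (complex_gaussian v) = UNIV"
  using sets_eq_imp_space_eq[OF sets_complex_gaussian] by simp

text \<open>The density never exceeds its value at 0, which is \<open>1 / sqrt (pi * v)\<close> for
  variance \<open>v / 2\<close>.\<close>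

lemma normal_interval_le:
  assumes "v > 0" and "r \<ge> 0"
  shows "emeasure (density lborel (\<lambda>x. ennreal (normal_density 0 (sqrt (v / 2)) x))) {-r..r}
    \<le> ennreal (2 * r / sqrt (pi * v))"
proof -
  have "normal_density 0 (sqrt (v / 2)) x \<le> 1 / sqrt (pi * v)" for x
    using assms by (simp add: normal_density_def divide_simps)
  then have "(\<integral>\<^sup>+x. ennreal (normal_density 0 (sqrt (v / 2)) x) * indicator {-r..r} x \<partial>lborel)
      \<le> (\<integral>\<^sup>+x. ennreal (1 / sqrt (pi * v)) * indicator {-r..r} x \<partial>lborel)"
    by (intro nn_integral_mono mult_right_mono ennreal_leI) auto
  also have "\<dots> = ennreal (1 / sqrt (pi * v)) * ennreal (2 * r)"
    using assms by (subst nn_integral_cmult_indicator) auto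
  also have "\<dots> = ennreal (2 * r / sqrt (pi * v))"
    using assms by (simp add: ennreal_mult[symmetric])
  finally show ?thesis
    by (simp add: emeasure_density)
qed

text \<open>The condition \<open>2 * r\<^sup>2 \<le> v\<close> keeps the exponent of the density
  above \<open>-1/2\<close> on the interval, so the density loses at most the factor
  \<open>exp (-1/2)\<close> against its peak.\<close>

lemma normal_interval_ge:
  assumes "v > 0" and "r \<ge> 0" and r: "2 * r\<^sup>2 \<le> v"
  shows "emeasure (density lborel (\<lambda>x. ennreal (normal_density 0 (sqrt (v / 2)) x))) {-r..r}
    \<ge> ennreal (2 * r * exp (-1/2) / sqrt (pi * v))"
proof -
  have d: "normal_density 0 (sqrt (v / 2)) x \<ge> exp (-1/2) / sqrt (pi * v)" if "x \<in> {-r..r}" for x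
  proof -
    have "x\<^sup>2 \<le> r\<^sup>2"
      using that by (intro abs_le_square_iff[THEN iffD1]) auto
    then have "x\<^sup>2 / v \<le> 1/2"
      using assms by (simp add: divide_simps)
    then have "exp (-1/2) \<le> exp (- (x\<^sup>2 / v))"
      by simp
    then show ?thesis
      using assms by (simp add: normal_density_def divide_simps)
  qed
  have "ennreal (2 * r * exp (-1/2) / sqrt (pi * v)) = ennreal (exp (-1/2) / sqrt (pi * v)) * ennreal (2 * r)"
    using assms by (simp add: ennreal_mult[symmetric] mult_ac)
  also have "\<dots> = (\<integral>\<^sup>+x. ennreal (exp (-1/2) / sqrt (pi * v)) * indicator {-r..r} x \<partial>lborel)"
    using assms by (subst nn_integral_cmult_indicator) auto
  also have "\<dots> \<le> (\<integral>\<^sup>+x. ennreal (normal_density 0 (sqrt (v / 2)) x) * indicator {-r..r} x \<partial>lborel)"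
    using d by (intro nn_integral_mono) (auto simp: indicator_def intro!: ennreal_leI)
  finally show ?thesis
    by (simp add: emeasure_density)
qed

lemma emeasure_complex_gaussian:
  assumes "v > 0" and "A \<in> sets borel"
  shows "emeasure (complex_gaussian v) A =
    (let N = density lborel (\<lambda>x. ennreal (normal_density 0 (sqrt (v / 2)) x))
     in emeasure (N \<Otimes>\<^sub>M N) {w. Complex (fst w) (snd w) \<in> A})"
proof -
  let ?N = "density lborel (\<lambda>x. ennreal (normal_density 0 (sqrt (v / 2)) x))"
  have "(\<lambda>(a, b). Complex a b) \<in> borel_measurable (?N \<Otimes>\<^sub>M ?N)"
    unfolding Complex_eq case_prod_beta by measurable
  then show ?thesis
    using assms
    by (simp add: complex_gaussian_def Let_def emeasure_distr case_prod_beta vimage_def space_pair_measure)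
qed

lemma sets_cmod_ball: "{c. (cmod c)\<^sup>2 \<le> s} \<in> sets borel"
  by measurable

text \<open>The disc lies in the square of half-side \<open>sqrt s\<close>, and the mass of a square
  factorises. The exact mass of the disc is \<open>1 - exp (- s / v)\<close>, but constants do not
  affect the asymptotics.\<close>

lemma complex_gaussian_ball_le:
  assumes "v > 0" and "s \<ge> 0"
  shows "emeasure (complex_gaussian v) {c. (cmod c)\<^sup>2 \<le> s} \<le> ennreal (2 * s / v)"
proof -
  let ?N = "density lborel (\<lambda>x. ennreal (normal_density 0 (sqrt (v / 2)) x))"
  let ?J = "{- sqrt s..sqrt s}"
  interpret N: prob_space ?N
    using assms by (intro prob_space_normal_density) simp
  have sub: "{w. Complex (fst w) (snd w) \<in> {c. (cmod c)\<^sup>2 \<le> s}} \<subseteq> ?J \<times> ?J"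
  proof
    fix w assume "w \<in> {w. Complex (fst w) (snd w) \<in> {c. (cmod c)\<^sup>2 \<le> s}}"
    then have *: "(fst w)\<^sup>2 + (snd w)\<^sup>2 \<le> s"
      by (simp add: cmod_power2)
    have "(fst w)\<^sup>2 \<le> s" "(snd w)\<^sup>2 \<le> s"
      using * zero_le_power2[of "fst w"] zero_le_power2[of "snd w"] by linarith+
    then have "\<bar>fst w\<bar> \<le> sqrt s" "\<bar>snd w\<bar> \<le> sqrt s"
      by (simp_all add: real_le_rsqrt)
    then show "w \<in> ?J \<times> ?J"
      by (cases w) auto
  qed
  have "emeasure (complex_gaussian v) {c. (cmod c)\<^sup>2 \<le> s} \<le> emeasure (?N \<Otimes>\<^sub>M ?N) (?J \<times> ?J)"
    using emeasure_mono[OF sub, of "?N \<Otimes>\<^sub>M ?N"] sets_cmod_ball[of s]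
    by (simp add: emeasure_complex_gaussian[OF assms(1)] Let_def)
  also have "\<dots> = emeasure ?N ?J * emeasure ?N ?J"
    by (intro N.emeasure_pair_measure_Times) auto
  also have "\<dots> \<le> ennreal (2 * sqrt s / sqrt (pi * v)) * ennreal (2 * sqrt s / sqrt (pi * v))"
    using assms by (intro mult_mono normal_interval_le) auto
  also have "\<dots> = ennreal (4 * s / (pi * v))"
    using assms by (simp add: ennreal_mult[symmetric])
  also have "\<dots> \<le> ennreal (2 * s / v)"
    using assms pi_ge_two mult_right_mono[OF pi_ge_two assms(2)]
    by (intro ennreal_leI) (simp add: field_simps)
  finally show ?thesis .
qed

text \<open>The disc contains the square of half-side \<open>sqrt (s / 2)\<close>. For this
  half-side the condition of \<open>normal_interval_ge\<close> becomes
  \<open>s \<le> v\<close>.\<close>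

lemma complex_gaussian_ball_ge:
  assumes "v > 0" and "0 \<le> s" and "s \<le> v"
  shows "ennreal (2 / (pi * exp 1) * s / v) \<le> emeasure (complex_gaussian v) {c. (cmod c)\<^sup>2 \<le> s}"
proof -
  let ?N = "density lborel (\<lambda>x. ennreal (normal_density 0 (sqrt (v / 2)) x))"
  let ?r = "sqrt (s / 2)"
  let ?J = "{- ?r..?r}"
  let ?B = "{w. Complex (fst w) (snd w) \<in> {c. (cmod c)\<^sup>2 \<le> s}}"
  interpret N: prob_space ?N
    using assms by (intro prob_space_normal_density) simp
  have sub: "?J \<times> ?J \<subseteq> ?B"
  proof
    fix w assume "w \<in> ?J \<times> ?J"
    then have "\<bar>fst w\<bar> \<le> ?r" "\<bar>snd w\<bar> \<le> ?r"
      by auto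
    then have "\<bar>fst w\<bar>\<^sup>2 \<le> ?r\<^sup>2" "\<bar>snd w\<bar>\<^sup>2 \<le> ?r\<^sup>2"
      by (intro power_mono; simp)+
    then show "w \<in> ?B"
      using assms by (simp add: cmod_power2)
  qed
  have B: "?B \<in> sets (?N \<Otimes>\<^sub>M ?N)"
  proof -
    have "{w \<in> space (?N \<Otimes>\<^sub>M ?N). (fst w)\<^sup>2 + (snd w)\<^sup>2 \<le> s} \<in> sets (?N \<Otimes>\<^sub>M ?N)"
      by measurable
    then show ?thesis
      by (simp add: cmod_power2 space_pair_measure)
  qed
  have "2 / (pi * exp 1) * s / v = (2 * ?r * exp (-1/2) / sqrt (pi * v)) * (2 * ?r * exp (-1/2) / sqrt (pi * v))"
  proof -
    have e: "exp (-1/2) * exp (-1/2) = 1 / exp (1::real)"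
      by (simp add: mult_exp_exp exp_minus inverse_eq_divide)
    have "(2 * ?r * exp (-1/2) / sqrt (pi * v)) * (2 * ?r * exp (-1/2) / sqrt (pi * v))
        = 4 * (?r * ?r) * (exp (-1/2) * exp (-1/2)) / (sqrt (pi * v) * sqrt (pi * v))"
      by simp
    also have "\<dots> = 2 / (pi * exp 1) * s / v"
      using assms unfolding e by simp
    finally show ?thesis by simp
  qed
  then have "ennreal (2 / (pi * exp 1) * s / v)
      = ennreal (2 * ?r * exp (-1/2) / sqrt (pi * v)) * ennreal (2 * ?r * exp (-1/2) / sqrt (pi * v))"
    using assms by (simp add: ennreal_mult[symmetric])
  also have "\<dots> \<le> emeasure ?N ?J * emeasure ?N ?J"
    using assms by (intro mult_mono normal_interval_ge) auto
  also have "\<dots> = emeasure (?N \<Otimes>\<^sub>M ?N) (?J \<times> ?J)"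
    by (intro N.emeasure_pair_measure_Times[symmetric]) auto
  also have "\<dots> \<le> emeasure (complex_gaussian v) {c. (cmod c)\<^sup>2 \<le> s}"
    using emeasure_mono[OF sub B] sets_cmod_ball[of s]
    by (simp add: emeasure_complex_gaussian[OF assms(1)] Let_def)
  finally show ?thesis .
qed

lemma emeasure_energy_law:
  "emeasure (energy_law M v) {..\<tau>} =
     emeasure (\<Pi>\<^sub>M _\<in>{1..M}. complex_gaussian v)
       {y \<in> space (\<Pi>\<^sub>M _\<in>{1..M}. complex_gaussian v). (\<Sum>t = 1..M. (cmod (y t))\<^sup>2) \<le> \<tau>}"
  unfolding energy_law_def
  by (subst emeasure_distr[OF measurable_total_energy]) (auto intro!: arg_cong2[where f = emeasure])

lemma emeasure_gaussian_box:
  assumes "v > 0"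
  shows "emeasure (\<Pi>\<^sub>M _\<in>{1..M}. complex_gaussian v) (PiE {1..M} (\<lambda>_. {c. (cmod c)\<^sup>2 \<le> s}))
    = emeasure (complex_gaussian v) {c. (cmod c)\<^sup>2 \<le> s} ^ M"
proof -
  interpret product_prob_space "\<lambda>_::nat. complex_gaussian v"
    using assms by (intro product_prob_spaceI prob_space_complex_gaussian)
  show ?thesis
    using sets_cmod_ball[of s] by (subst emeasure_PiM) auto
qed

text \<open>If the sum of squared moduli is at most \<open>\<tau>\<close>, so is each summand; this
  encloses the event in a box whose probability is a power.\<close>

lemma energy_law_atMost_le:
  assumes "v > 0" and "\<tau> \<ge> 0"
  shows "measure (energy_law M v) {..\<tau>} \<le> (2 * \<tau> / v) ^ M"
proof -
  let ?P = "\<Pi>\<^sub>M _\<in>{1..M}. complex_gaussian v"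
  interpret E: prob_space "energy_law M v"
    by (rule prob_space_energy_law[OF assms(1)])
  have sub: "{y \<in> space ?P. (\<Sum>t = 1..M. (cmod (y t))\<^sup>2) \<le> \<tau>} \<subseteq> PiE {1..M} (\<lambda>_. {c. (cmod c)\<^sup>2 \<le> \<tau>})"
  proof
    fix y assume y: "y \<in> {y \<in> space ?P. (\<Sum>t = 1..M. (cmod (y t))\<^sup>2) \<le> \<tau>}"
    have "(cmod (y t))\<^sup>2 \<le> \<tau>" if "t \<in> {1..M}" for t
      using y member_le_sum[OF that, of "\<lambda>t. (cmod (y t))\<^sup>2"] by auto
    then show "y \<in> PiE {1..M} (\<lambda>_. {c. (cmod c)\<^sup>2 \<le> \<tau>})"
      using y by (auto simp: space_PiM PiE_def)
  qed
  have "emeasure (energy_law M v) {..\<tau>} \<le> emeasure ?P (PiE {1..M} (\<lambda>_. {c. (cmod c)\<^sup>2 \<le> \<tau>}))"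
    unfolding emeasure_energy_law
    by (rule emeasure_mono[OF sub]) (auto intro!: sets_PiM_I_finite simp: sets_cmod_ball)
  also have "\<dots> \<le> ennreal (2 * \<tau> / v) ^ M"
    unfolding emeasure_gaussian_box[OF assms(1)]
    by (intro power_mono complex_gaussian_ball_le assms) auto
  also have "\<dots> = ennreal ((2 * \<tau> / v) ^ M)"
    using assms by (simp add: ennreal_power)
  finally show ?thesis
    using assms by (simp add: E.emeasure_eq_measure)
qed

text \<open>If each squared modulus is at most \<open>\<tau> / M\<close>, the sum is at most
  \<open>\<tau>\<close>. The inner box has the same order of probability as the outer one, with a
  constant depending only on \<open>M\<close>.\<close>

lemma energy_law_atMost_ge:
  assumes "v > 0" and "0 \<le> \<tau>" and "\<tau> \<le> v" and "M \<ge> 1"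
  shows "(2 / (pi * exp 1 * real M) * \<tau> / v) ^ M \<le> measure (energy_law M v) {..\<tau>}"
proof -
  let ?P = "\<Pi>\<^sub>M _\<in>{1..M}. complex_gaussian v"
  let ?s = "\<tau> / real M"
  interpret E: prob_space "energy_law M v"
    by (rule prob_space_energy_law[OF assms(1)])
  have sub: "PiE {1..M} (\<lambda>_. {c. (cmod c)\<^sup>2 \<le> ?s}) \<subseteq> {y \<in> space ?P. (\<Sum>t = 1..M. (cmod (y t))\<^sup>2) \<le> \<tau>}"
  proof
    fix y assume y: "y \<in> PiE {1..M} (\<lambda>_. {c. (cmod c)\<^sup>2 \<le> ?s})"
    have "(\<Sum>t = 1..M. (cmod (y t))\<^sup>2) \<le> (\<Sum>t = 1..M. ?s)"
      using y by (intro sum_mono) auto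
    also have "\<dots> = \<tau>"
      using assms by simp
    finally show "y \<in> {y \<in> space ?P. (\<Sum>t = 1..M. (cmod (y t))\<^sup>2) \<le> \<tau>}"
      using y by (auto simp: space_PiM PiE_def)
  qed
  have s: "0 \<le> ?s" "?s \<le> v"
    using assms divide_left_mono[of 1 "real M" \<tau>] by auto
  have "ennreal ((2 / (pi * exp 1 * real M) * \<tau> / v) ^ M) = ennreal (2 / (pi * exp 1) * ?s / v) ^ M"
    using assms by (subst ennreal_power) (auto simp: mult_ac)
  also have "\<dots> \<le> emeasure ?P (PiE {1..M} (\<lambda>_. {c. (cmod c)\<^sup>2 \<le> ?s}))"
    unfolding emeasure_gaussian_box[OF assms(1)]
    by (intro power_mono complex_gaussian_ball_ge assms s) auto
  also have "\<dots> \<le> emeasure (energy_law M v) {..\<tau>}"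
    unfolding emeasure_energy_law
    using measurable_sets[OF measurable_total_energy[of M v], of "{..\<tau>}"]
    by (intro emeasure_mono[OF sub]) (simp add: vimage_def Int_def conj_commute)
  finally show ?thesis
    by (simp add: E.emeasure_eq_measure)
qed

subsection \<open>Error probability at finite size\<close>

text \<open>In a sorted list the elements below \<open>a\<close> form an initial segment, so only
  its length matters.\<close>

lemma le_nth_sorted_iff:
  fixes a :: "'a :: linorder"
  assumes "sorted xs" and "k < length xs"
  shows "a \<le> xs ! k \<longleftrightarrow> length (filter (\<lambda>x. x < a) xs) \<le> k"
proof -
  have len: "length (filter (\<lambda>x. x < a) xs) = card {i. i < length xs \<and> xs ! i < a}"
    by (rule length_filter_conv_card)
  show ?thesis
  proof
    assume a: "a \<le> xs ! k"
    have "{i. i < length xs \<and> xs ! i < a} \<subseteq> {..<k}"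
    proof
      fix i assume i: "i \<in> {i. i < length xs \<and> xs ! i < a}"
      have "\<not> k \<le> i"
        using sorted_nth_mono[OF assms(1), of k i] i a by auto
      then show "i \<in> {..<k}" by simp
    qed
    from card_mono[OF _ this] show "length (filter (\<lambda>x. x < a) xs) \<le> k"
      by (simp add: len)
  next
    assume *: "length (filter (\<lambda>x. x < a) xs) \<le> k"
    show "a \<le> xs ! k"
    proof (rule ccontr)
      assume "\<not> a \<le> xs ! k"
      then have "{..k} \<subseteq> {i. i < length xs \<and> xs ! i < a}"
        using assms(2) by (auto simp: not_le intro: le_less_trans[OF sorted_nth_mono[OF assms(1)]])
      from card_mono[OF _ this] * show False
        by (simp add: len)
    qed
  qed
qed

text \<open>This removes sorting from the argument: a channel is detected exactly if fewer than
  \<open>T\<close> channels have strictly smaller energy, whatever the ties.\<close>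

lemma le_order_statistic_iff:
  assumes "1 \<le> T" and "T \<le> n"
  shows "a \<le> order_statistic n T y \<longleftrightarrow> card {j \<in> {1..n}. y j < a} < T"
proof -
  let ?ys = "map y [1..<Suc n]"
  have "a \<le> order_statistic n T y \<longleftrightarrow> length (filter (\<lambda>x. x < a) (sort ?ys)) \<le> T - 1"
    unfolding order_statistic_def using assms by (intro le_nth_sorted_iff) auto
  also have "length (filter (\<lambda>x. x < a) (sort ?ys)) = length (filter (\<lambda>j. y j < a) [1..<Suc n])"
    by (simp add: filter_sort filter_map o_def del: upt_Suc)
  also have "\<dots> = card {j \<in> {1..n}. y j < a}"
    by (subst distinct_card[symmetric]) (auto intro!: arg_cong[where f = card])
  finally show ?thesis
    using assms by auto
qed

section \<open>Probabilities of events defined channel by channel\<close>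

lemma pred_sensing_law:
  assumes "\<And>i. i \<in> {1..n} \<Longrightarrow> p i > 0" and "Measurable.pred (sensing_space n M) P"
  shows "{w \<in> space (sensing_law n M e p). P w} \<in> sets (sensing_law n M e p)"
proof -
  have s: "sets (sensing_law n M e p) = sets (sensing_space n M)"
    by (rule sets_sensing_law[OF assms(1)])
  show ?thesis
    unfolding s sets_eq_imp_space_eq[OF s] by (rule assms(2)[unfolded pred_def])
qed

lemma prob_all_channels:
  assumes p: "\<And>i. i \<in> {1..n} \<Longrightarrow> p i > 0" and "n \<ge> 1" and "M \<ge> 1" and e: "0 \<le> e" "e \<le> 1"
    and R: "\<And>b. Measurable.pred borel (R b)"
  shows "measure (sensing_law n M e p)
      {w \<in> space (sensing_law n M e p). \<forall>i\<in>{1..n}. R (fst w i) (energy M (snd w) i)}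
    = (\<Prod>i\<in>{1..n}. measure (energy_law M 1) {y. R False y} * e
        + measure (energy_law M (1 + p i)) {y. R True y} * (1 - e))"
proof -
  let ?S = "sensing_law n M e p"
  let ?A = "{w \<in> space ?S. \<forall>i\<in>{1..n}. R (fst w i) (energy M (snd w) i)}"
  interpret S: prob_space ?S
    by (rule prob_space_sensing_law[OF p])
  have E: "emeasure (energy_law M v) A = ennreal (measure (energy_law M v) A)" if "v > 0" for v A
  proof -
    interpret prob_space "energy_law M v"
      by (rule prob_space_energy_law[OF that])
    show ?thesis by (simp add: emeasure_eq_measure)
  qed
  have RB: "{y. R b y} \<in> sets borel" for b
    using R[of b] by (simp add: pred_def)
  have "Measurable.pred (sensing_space n M) (\<lambda>w. \<forall>i\<in>{1..n}. R (fst w i) (energy M (snd w) i))"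
    by (intro pred_intros_finite measurable_occupancy_energy[where f = R] R) auto
  then have A: "?A \<in> sets ?S"
    by (intro pred_sensing_law p)
  have "emeasure ?S ?A = (\<integral>\<^sup>+w. indicator ?A w \<partial>?S)"
    by (rule nn_integral_indicator[OF A, symmetric])
  \<comment> \<open>The indicator of a conjunction over channels is a product of indicators, the
    form that the product formula accepts.\<close>
  also have "\<dots> = (\<integral>\<^sup>+w. (\<Prod>i\<in>{1..n}. indicator {y. R (fst w i) y} (energy M (snd w) i)) \<partial>?S)"
    by (intro nn_integral_cong) (auto simp: indicator_def prod_zero_iff)
  also have "\<dots> = (\<Prod>i\<in>{1..n}. (\<integral>\<^sup>+y. indicator {y. R False y} y \<partial>energy_law M 1) * ennreal e
           + (\<integral>\<^sup>+y. indicator {y. R True y} y \<partial>energy_law M (1 + p i)) * ennreal (1 - e))"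
    using assms RB
    by (intro nn_integral_prod_sensing_law[where f = "\<lambda>i b. indicator {y. R b y}"]) auto
  also have "\<dots> = (\<Prod>i\<in>{1..n}. ennreal (measure (energy_law M 1) {y. R False y} * e
        + measure (energy_law M (1 + p i)) {y. R True y} * (1 - e)))"
  proof (rule prod.cong[OF refl])
    fix i assume "i \<in> {1..n}"
    then have "1 + p i > 0"
      using p[of i] by simp
    then show "(\<integral>\<^sup>+y. indicator {y. R False y} y \<partial>energy_law M 1) * ennreal e
           + (\<integral>\<^sup>+y. indicator {y. R True y} y \<partial>energy_law M (1 + p i)) * ennreal (1 - e)
        = ennreal (measure (energy_law M 1) {y. R False y} * e
        + measure (energy_law M (1 + p i)) {y. R True y} * (1 - e))"
      using e RB by (simp add: E ennreal_mult)
  qed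
  also have "\<dots> = ennreal (\<Prod>i\<in>{1..n}. measure (energy_law M 1) {y. R False y} * e
        + measure (energy_law M (1 + p i)) {y. R True y} * (1 - e))"
    using e by (intro prod_ennreal) simp
  finally show ?thesis
    using e by (simp add: S.emeasure_eq_measure prod_nonneg)
qed

lemma error_prob_eq:
  assumes "1 \<le> T" and "T \<le> n"
  shows "error_prob n T M e p = measure (sensing_law n M e p)
    {w \<in> space (sensing_law n M e p). \<exists>i\<in>{1..n}. fst w i \<and>
       card {j \<in> {1..n}. energy M (snd w) j < energy M (snd w) i} < T}"
  unfolding error_prob_def detected_def occupied_def le_order_statistic_iff[OF assms]
  by (intro arg_cong2[where f = measure] refl) auto

text \<open>The cardinality is a finite sum of indicators, hence a measurable real function.\<close>

lemma pred_card_less: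
  assumes "finite I" and P: "\<And>i. i \<in> I \<Longrightarrow> Measurable.pred N (\<lambda>w. P w i)"
  shows "Measurable.pred N (\<lambda>w. card {i \<in> I. P w i} < k)"
proof -
  have [measurable]: "(\<lambda>w. \<Sum>i\<in>I. if P w i then 1 else 0 :: real) \<in> borel_measurable N"
    using P by (intro borel_measurable_sum measurable_If) (auto simp: pred_def)
  have "real (card {i \<in> I. P w i}) = (\<Sum>i\<in>I. if P w i then 1 else 0)" for w
    using assms(1) by (simp add: sum.If_cases Int_def)
  then have "card {i \<in> I. P w i} < k \<longleftrightarrow> (\<Sum>i\<in>I. if P w i then 1 else 0 :: real) < real k" for w
    by (metis of_nat_less_iff)
  then show ?thesis
    by simp
qed

text \<open>The lower bound on the error probability places another event inside this one, and
  monotonicity of \<open>measure\<close> requires the larger set to be measurable.\<close>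

lemma error_event_measurable:
  "Measurable.pred (sensing_space n M) (\<lambda>w. \<exists>i\<in>{1..n}. fst w i \<and>
       card {j \<in> {1..n}. energy M (snd w) j < energy M (snd w) i} < T)"
proof (intro pred_intros_finite(4) pred_intros_logic(3) pred_card_less)
  fix i assume i: "i \<in> {1..n}"
  show "Measurable.pred (sensing_space n M) (\<lambda>w. fst w i)"
    by (rule measurable_compose[OF measurable_fst]) simp
  fix j assume j: "j \<in> {1..n}"
  show "Measurable.pred (sensing_space n M) (\<lambda>w. energy M (snd w) j < energy M (snd w) i)"
    by (rule borel_measurable_pred_less[OF measurable_energy_snd[OF j] measurable_energy_snd[OF i]])
qed auto

text \<open>Markov's inequality for \<open>(1/2) ^ N\<close>, where \<open>N\<close> counts the holes of energy at most \<open>\<tau>\<close>.\<close>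

lemma prob_few_quiet_holes_le:
  assumes p: "\<And>i. i \<in> {1..n} \<Longrightarrow> p i > 0" and "n \<ge> 1" and "M \<ge> 1" and e: "0 \<le> e" "e \<le> 1"
  shows "measure (sensing_law n M e p) {w \<in> space (sensing_law n M e p).
      card {i \<in> {1..n}. \<not> fst w i \<and> energy M (snd w) i \<le> \<tau>} < T}
    \<le> 2 ^ T * (1 - e * measure (energy_law M 1) {..\<tau>} / 2) ^ n"
proof -
  let ?S = "sensing_law n M e p"
  let ?N = "\<lambda>w. card {i \<in> {1..n}. \<not> fst w i \<and> energy M (snd w) i \<le> \<tau>}"
  let ?A = "{w \<in> space ?S. ?N w < T}"
  let ?F = "measure (energy_law M 1) {..\<tau>}"
  \<comment> \<open>Each quiet hole contributes a factor \<open>1 / 2\<close>, so the product over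
    the channels is \<open>(1 / 2) ^ ?N w\<close>.\<close>
  let ?f = "\<lambda>b y. ennreal (if \<not> b \<and> y \<le> \<tau> then 1 / 2 else 1)"
  interpret S: prob_space ?S
    by (rule prob_space_sensing_law[OF p])
  interpret E: prob_space "energy_law M 1"
    by (rule prob_space_energy_law) simp
  have fm: "?f b \<in> borel_measurable borel" for b
    by measurable
  have prod_f: "(\<Prod>i\<in>{1..n}. ?f (fst w i) (energy M (snd w) i)) = ennreal ((1 / 2) ^ ?N w)" for w
    by (subst prod_ennreal) (auto simp: prod.If_cases Int_def)
  have False_part: "(\<integral>\<^sup>+y. ?f False y \<partial>energy_law M 1) = ennreal (1 - ?F / 2)"
  proof -
    have i: "integrable (energy_law M 1) (indicator {..\<tau>} :: real \<Rightarrow> real)"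
      by (intro integrable_real_indicator) (auto simp: E.emeasure_eq_measure)
    have "(\<integral>\<^sup>+y. ?f False y \<partial>energy_law M 1)
        = (\<integral>\<^sup>+y. ennreal (1 - indicator {..\<tau>} y / 2) \<partial>energy_law M 1)"
      by (intro nn_integral_cong) (auto simp: indicator_def)
    also have "\<dots> = ennreal (\<integral>y. 1 - indicator {..\<tau>} y / 2 \<partial>energy_law M 1)"
    proof (rule nn_integral_eq_integral)
      show "integrable (energy_law M 1) (\<lambda>y. 1 - indicator {..\<tau>} y / 2 :: real)"
        using i by simp
    qed (simp split: split_indicator)
    also have "(\<integral>y. 1 - indicator {..\<tau>} y / 2 \<partial>energy_law M 1) = 1 - ?F / 2"
      using i by (simp add: E.prob_space[simplified])
    finally show ?thesis .
  qed
  have True_part: "(\<integral>\<^sup>+y. ?f True y \<partial>energy_law M (1 + p i)) = 1" if "i \<in> {1..n}" for i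
  proof -
    interpret Ei: prob_space "energy_law M (1 + p i)"
      using p[OF that] by (intro prob_space_energy_law) simp
    show ?thesis
      using Ei.emeasure_space_1 by simp
  qed
  have F1: "?F \<le> 1"
    by simp
  have "ennreal (measure ?S ?A) = emeasure ?S ?A"
    by (simp add: S.emeasure_eq_measure)
  also have "\<dots> \<le> (\<integral>\<^sup>+w. 2 ^ T * (\<Prod>i\<in>{1..n}. ?f (fst w i) (energy M (snd w) i)) \<partial>?S)"
  \<comment> \<open>A set outside the sigma-algebra has measure 0 by convention, so the bound holds
    in either case.\<close>
  proof (cases "?A \<in> sets ?S")
    case True
    have "emeasure ?S ?A = (\<integral>\<^sup>+w. indicator ?A w \<partial>?S)"
      by (rule nn_integral_indicator[OF True, symmetric])
    also have "\<dots> \<le> (\<integral>\<^sup>+w. 2 ^ T * (\<Prod>i\<in>{1..n}. ?f (fst w i) (energy M (snd w) i)) \<partial>?S)"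
    proof (rule nn_integral_mono)
      fix w
      have "1 \<le> 2 ^ T * (1 / 2 :: real) ^ ?N w" if "?N w < T"
        using power_increasing[of "?N w" T "2 :: real"] that by (simp add: power_divide)
      then have "indicator ?A w \<le> ennreal (2 ^ T * (1 / 2) ^ ?N w)"
        by (auto simp: indicator_def)
      also have "\<dots> = 2 ^ T * (\<Prod>i\<in>{1..n}. ?f (fst w i) (energy M (snd w) i))"
        by (simp only: prod_f) (simp add: ennreal_mult ennreal_power[symmetric])
      finally show "indicator ?A w \<le> 2 ^ T * (\<Prod>i\<in>{1..n}. ?f (fst w i) (energy M (snd w) i))" .
    qed
    finally show ?thesis .
  next
    case False
    then have "emeasure ?S ?A = 0"
      by (rule emeasure_notin_sets)
    then show ?thesis
      by (simp only: zero_le)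
  qed
  also have "\<dots> = 2 ^ T * (\<integral>\<^sup>+w. (\<Prod>i\<in>{1..n}. ?f (fst w i) (energy M (snd w) i)) \<partial>?S)"
  proof (rule nn_integral_cmult)
    have sS: "sets ?S = sets (sensing_space n M)"
      by (rule sets_sensing_law[OF p])
    have "(\<lambda>w. ?f (fst w i) (energy M (snd w) i)) \<in> borel_measurable (sensing_space n M)"
      if "i \<in> {1..n}" for i
      by (rule measurable_occupancy_energy[where f = ?f, OF that fm])
    then have "(\<lambda>w. ?f (fst w i) (energy M (snd w) i)) \<in> borel_measurable ?S"
      if "i \<in> {1..n}" for i
      unfolding measurable_cong_sets[OF sS refl] using that .
    then show "(\<lambda>w. \<Prod>i\<in>{1..n}. ?f (fst w i) (energy M (snd w) i)) \<in> borel_measurable ?S"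
      by (rule borel_measurable_prod_ennreal)
  qed
  also have "(\<integral>\<^sup>+w. (\<Prod>i\<in>{1..n}. ?f (fst w i) (energy M (snd w) i)) \<partial>?S)
    = (\<Prod>i\<in>{1..n}. (\<integral>\<^sup>+y. ?f False y \<partial>energy_law M 1) * ennreal e
           + (\<integral>\<^sup>+y. ?f True y \<partial>energy_law M (1 + p i)) * ennreal (1 - e))"
    using assms fm by (intro nn_integral_prod_sensing_law[where f = "\<lambda>i b. ?f b"]) auto
  also have "\<dots> = (\<Prod>i\<in>{1..n}. ennreal (1 - e * ?F / 2))"
  proof (rule prod.cong[OF refl])
    fix i assume i: "i \<in> {1..n}"
    \<comment> \<open>Average weight of one channel: a hole gives \<open>1 - ?F / 2\<close>, an
      occupied channel gives 1.\<close>
    have "ennreal (1 - ?F / 2) * ennreal e + 1 * ennreal (1 - e) = ennreal ((1 - ?F / 2) * e + (1 - e))"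
      using e F1 by (simp add: ennreal_mult del: E.prob_le_1)
    also have "(1 - ?F / 2) * e + (1 - e) = 1 - e * ?F / 2"
      by (simp add: field_simps)
    finally show "(\<integral>\<^sup>+y. ?f False y \<partial>energy_law M 1) * ennreal e
           + (\<integral>\<^sup>+y. ?f True y \<partial>energy_law M (1 + p i)) * ennreal (1 - e) = ennreal (1 - e * ?F / 2)"
      unfolding False_part True_part[OF i] .
  qed
  finally have *: "ennreal (measure ?S ?A) \<le> 2 ^ T * ennreal (1 - e * ?F / 2) ^ n"
    by simp
  have ge: "0 \<le> 1 - e * ?F / 2"
    using mult_le_one[of e ?F] e F1 by (simp del: E.prob_le_1)
  have "2 ^ T * ennreal (1 - e * ?F / 2) ^ n = ennreal (2 ^ T * (1 - e * ?F / 2) ^ n)"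
    using ge by (simp add: ennreal_mult ennreal_power[symmetric])
  with * ge show ?thesis
    by (simp add: ennreal_le_iff)
qed

text \<open>A union bound in product form: the complementary event factorises over the channels,
  each factor is at least \<open>1 - (2 * \<tau> / g) ^ M\<close>, and Bernoulli's inequality
  linearises the power. Replacing the variance \<open>1 + p i\<close> by the smaller
  \<open>g\<close> makes the bound uniform over the admissible powers.\<close>

lemma prob_quiet_occupied_le:
  assumes p: "\<And>i. i \<in> {1..n} \<Longrightarrow> g \<le> p i" and "g > 0" and "n \<ge> 1" and "M \<ge> 1"
    and e: "0 \<le> e" "e \<le> 1" and "\<tau> \<ge> 0"
  shows "measure (sensing_law n M e p) {w \<in> space (sensing_law n M e p).
      \<exists>i\<in>{1..n}. fst w i \<and> energy M (snd w) i \<le> \<tau>} \<le> real n * (2 * \<tau> / g) ^ M"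
proof -
  let ?S = "sensing_law n M e p"
  let ?A = "{w \<in> space ?S. \<forall>i\<in>{1..n}. \<not> (fst w i \<and> energy M (snd w) i \<le> \<tau>)}"
  let ?u = "(2 * \<tau> / g) ^ M"
  have p0: "p i > 0" if "i \<in> {1..n}" for i
    using p[OF that] assms(2) by simp
  interpret S: prob_space ?S
    by (rule prob_space_sensing_law[OF p0])
  interpret E: prob_space "energy_law M 1"
    by (rule prob_space_energy_law) simp
  show ?thesis
  proof (cases "?u \<le> 1")
    \<comment> \<open>Here the claimed bound exceeds 1; Bernoulli's inequality needs the other
      case.\<close>
    case False
    then have "1 * 1 \<le> real n * ?u"
      using assms by (intro mult_mono) auto
    then show ?thesis
      by (intro order_trans[OF S.prob_le_1]) simp
  next
    case True
    have A: "?A \<in> sets ?S"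
    proof (rule pred_sensing_law[OF p0])
      show "Measurable.pred (sensing_space n M) (\<lambda>w. \<forall>i\<in>{1..n}. \<not> (fst w i \<and> energy M (snd w) i \<le> \<tau>))"
        by (intro pred_intros_finite measurable_occupancy_energy[where f = "\<lambda>b y. \<not> (b \<and> y \<le> \<tau>)"]) auto
    qed auto
    have "measure ?S ?A = (\<Prod>i\<in>{1..n}. measure (energy_law M 1) {y. \<not> (False \<and> y \<le> \<tau>)} * e
        + measure (energy_law M (1 + p i)) {y. \<not> (True \<and> y \<le> \<tau>)} * (1 - e))"
      using assms p0 by (intro prob_all_channels[where R = "\<lambda>b y. \<not> (b \<and> y \<le> \<tau>)"]) auto
    also have "\<dots> \<ge> (\<Prod>i\<in>{1..n}. 1 - ?u)"
    proof (intro prod_mono conjI)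
      fix i assume i: "i \<in> {1..n}"
      interpret Ei: prob_space "energy_law M (1 + p i)"
        using p0[OF i] by (intro prob_space_energy_law) simp
      have "measure (energy_law M (1 + p i)) {..\<tau>} \<le> (2 * \<tau> / (1 + p i)) ^ M"
        using p0[OF i] assms by (intro energy_law_atMost_le) auto
      also have "\<dots> \<le> ?u"
        using p[OF i] assms by (intro power_mono divide_left_mono) auto
      finally have F: "measure (energy_law M (1 + p i)) {..\<tau>} \<le> ?u" .
      have eqs: "measure (energy_law M (1 + p i)) {y. \<not> (True \<and> y \<le> \<tau>)}
          = 1 - measure (energy_law M (1 + p i)) {..\<tau>}"
        "measure (energy_law M 1) {y. \<not> (False \<and> y \<le> \<tau>)} = 1"
        using Ei.prob_compl[of "{..\<tau>}"] E.prob_space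
        by (simp_all add: Compl_eq_Diff_UNIV[symmetric] Compl_eq)
      have "measure (energy_law M (1 + p i)) {..\<tau>} * (1 - e) \<le> measure (energy_law M (1 + p i)) {..\<tau>}"
        using e by (intro mult_left_le) auto
      with F show "1 - ?u \<le> measure (energy_law M 1) {y. \<not> (False \<and> y \<le> \<tau>)} * e
          + measure (energy_law M (1 + p i)) {y. \<not> (True \<and> y \<le> \<tau>)} * (1 - e)"
        unfolding eqs by (simp add: algebra_simps)
    qed (use True in simp)
    also have "(\<Prod>i\<in>{1..n}. 1 - ?u) = (1 + (- ?u)) ^ n"
      by simp
    also have "\<dots> \<ge> 1 + real n * (- ?u)"
      using True by (intro Bernoulli_inequality) simp
    finally have "1 - real n * ?u \<le> measure ?S ?A"
      by simp
    moreover have "measure ?S (space ?S - ?A) = 1 - measure ?S ?A"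
      by (rule S.prob_compl[OF A])
    moreover have "space ?S - ?A = {w \<in> space ?S. \<exists>i\<in>{1..n}. fst w i \<and> energy M (snd w) i \<le> \<tau>}"
      by auto
    ultimately show ?thesis
      by simp
  qed
qed

text \<open>An error forces one of two events: fewer than \<open>T\<close> quiet holes, or a quiet
  occupied channel. The two preceding bounds are added.\<close>

lemma error_prob_le:
  assumes p: "\<And>i. i \<in> {1..n} \<Longrightarrow> g \<le> p i" and "g > 0" and "1 \<le> T" and "T \<le> n" and "M \<ge> 1"
    and e: "0 \<le> e" "e \<le> 1" and "\<tau> \<ge> 0"
  shows "error_prob n T M e p
    \<le> 2 ^ T * (1 - e * measure (energy_law M 1) {..\<tau>} / 2) ^ n + real n * (2 * \<tau> / g) ^ M"
proof -
  let ?S = "sensing_law n M e p"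
  let ?A = "{w \<in> space ?S. card {i \<in> {1..n}. \<not> fst w i \<and> energy M (snd w) i \<le> \<tau>} < T}"
  let ?B = "{w \<in> space ?S. \<exists>i\<in>{1..n}. fst w i \<and> energy M (snd w) i \<le> \<tau>}"
  have p0: "p i > 0" if "i \<in> {1..n}" for i
    using p[OF that] assms(2) by simp
  interpret S: prob_space ?S
    by (rule prob_space_sensing_law[OF p0])
  have A: "?A \<in> sets ?S"
  proof (rule pred_sensing_law[OF p0])
    show "Measurable.pred (sensing_space n M)
        (\<lambda>w. card {i \<in> {1..n}. \<not> fst w i \<and> energy M (snd w) i \<le> \<tau>} < T)"
      by (intro pred_card_less measurable_occupancy_energy[where f = "\<lambda>b y. \<not> b \<and> y \<le> \<tau>"]) auto
  qed auto
  have B: "?B \<in> sets ?S"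
  proof (rule pred_sensing_law[OF p0])
    show "Measurable.pred (sensing_space n M) (\<lambda>w. \<exists>i\<in>{1..n}. fst w i \<and> energy M (snd w) i \<le> \<tau>)"
      by (intro pred_intros_finite measurable_occupancy_energy[where f = "\<lambda>b y. b \<and> y \<le> \<tau>"]) auto
  qed auto
  have "error_prob n T M e p \<le> measure ?S (?A \<union> ?B)"
    unfolding error_prob_eq[OF assms(3,4)]
  proof (rule S.finite_measure_mono)
    show "{w \<in> space ?S. \<exists>i\<in>{1..n}. fst w i \<and>
       card {j \<in> {1..n}. energy M (snd w) j < energy M (snd w) i} < T} \<subseteq> ?A \<union> ?B"
    proof
      fix w assume "w \<in> {w \<in> space ?S. \<exists>i\<in>{1..n}. fst w i \<and>
       card {j \<in> {1..n}. energy M (snd w) j < energy M (snd w) i} < T}"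
      then obtain i where w: "w \<in> space ?S" "i \<in> {1..n}" "fst w i"
        and c: "card {j \<in> {1..n}. energy M (snd w) j < energy M (snd w) i} < T"
        by auto
      show "w \<in> ?A \<union> ?B"
      proof (cases "energy M (snd w) i \<le> \<tau>")
        \<comment> \<open>Every quiet hole now has strictly smaller energy than the detected channel
          \<open>i\<close>, so there are fewer than \<open>T\<close> of them.\<close>
        case False
        then have "card {j \<in> {1..n}. \<not> fst w j \<and> energy M (snd w) j \<le> \<tau>}
            \<le> card {j \<in> {1..n}. energy M (snd w) j < energy M (snd w) i}"
          by (intro card_mono) auto
        with c w show ?thesis by auto
      qed (use w in auto)
    qed
    show "?A \<union> ?B \<in> sets ?S"
      using A B by (rule sets.Un)
  qed
  also have "\<dots> \<le> measure ?S ?A + measure ?S ?B"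
    using A B by (rule measure_Un_le)
  also have "\<dots> \<le> 2 ^ T * (1 - e * measure (energy_law M 1) {..\<tau>} / 2) ^ n + real n * (2 * \<tau> / g) ^ M"
    using assms p0 by (intro add_mono prob_few_quiet_holes_le prob_quiet_occupied_le) auto
  finally show ?thesis .
qed

text \<open>For a single channel, \<open>a\<close> is the probability of being a quiet hole and
  \<open>b\<close> of being quiet and occupied. The left side is therefore the probability that some
  channel is quiet but no hole is, as the second of the two subtracted events is contained in the
  first.\<close>

lemma error_prob_ge:
  fixes e g \<tau> :: real
  assumes "g > 0" and "1 \<le> T" and "T \<le> n" and "M \<ge> 1" and e: "0 \<le> e" "e \<le> 1"
  defines "a \<equiv> e * measure (energy_law M 1) {..\<tau>}"
    and "b \<equiv> (1 - e) * measure (energy_law M (1 + g)) {..\<tau>}"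
  shows "(1 - a) ^ n - (1 - a - b) ^ n \<le> error_prob n T M e (\<lambda>_. g)"
proof -
  let ?S = "sensing_law n M e (\<lambda>_. g)"
  let ?A = "{w \<in> space ?S. \<forall>i\<in>{1..n}. \<not> (\<not> fst w i \<and> energy M (snd w) i \<le> \<tau>)}"
  let ?B = "{w \<in> space ?S. \<forall>i\<in>{1..n}. \<not> (energy M (snd w) i \<le> \<tau>)}"
  interpret S: prob_space ?S
    using assms by (intro prob_space_sensing_law)
  have c: "measure (energy_law M v) {y. \<not> y \<le> \<tau>} = 1 - measure (energy_law M v) {..\<tau>}"
    and u: "measure (energy_law M v) UNIV = 1" if "v > 0" for v
  proof -
    interpret E: prob_space "energy_law M v"
      by (rule prob_space_energy_law[OF that])
    show "measure (energy_law M v) {y. \<not> y \<le> \<tau>} = 1 - measure (energy_law M v) {..\<tau>}"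
      using E.prob_compl[of "{..\<tau>}"] by (simp add: Compl_eq_Diff_UNIV[symmetric] Compl_eq)
    show "measure (energy_law M v) UNIV = 1"
      using E.prob_space by simp
  qed
  have "measure ?S ?A = (\<Prod>i\<in>{1..n}. measure (energy_law M 1) {y. \<not> (\<not> False \<and> y \<le> \<tau>)} * e
        + measure (energy_law M (1 + g)) {y. \<not> (\<not> True \<and> y \<le> \<tau>)} * (1 - e))"
    using assms by (intro prob_all_channels[where R = "\<lambda>b y. \<not> (\<not> b \<and> y \<le> \<tau>)"]) auto
  also have "\<dots> = (1 - a) ^ n"
    using assms by (simp add: c[simplified] u a_def algebra_simps)
  finally have mA: "measure ?S ?A = (1 - a) ^ n" .
  have "measure ?S ?B = (\<Prod>i\<in>{1..n}. measure (energy_law M 1) {y. \<not> y \<le> \<tau>} * e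
        + measure (energy_law M (1 + g)) {y. \<not> y \<le> \<tau>} * (1 - e))"
    using assms by (intro prob_all_channels[where R = "\<lambda>b y. \<not> y \<le> \<tau>"]) auto
  also have "\<dots> = (1 - a - b) ^ n"
    using assms by (simp add: c[simplified] a_def b_def algebra_simps)
  finally have mB: "measure ?S ?B = (1 - a - b) ^ n" .
  have A: "?A \<in> sets ?S"
  proof (rule pred_sensing_law)
    show "Measurable.pred (sensing_space n M) (\<lambda>w. \<forall>i\<in>{1..n}. \<not> (\<not> fst w i \<and> energy M (snd w) i \<le> \<tau>))"
      by (intro pred_intros_finite measurable_occupancy_energy[where f = "\<lambda>b y. \<not> (\<not> b \<and> y \<le> \<tau>)"]) auto
  qed (use assms in auto)
  have B: "?B \<in> sets ?S"
  proof (rule pred_sensing_law)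
    show "Measurable.pred (sensing_space n M) (\<lambda>w. \<forall>i\<in>{1..n}. \<not> (energy M (snd w) i \<le> \<tau>))"
      by (intro pred_intros_finite measurable_occupancy_energy[where f = "\<lambda>b y. \<not> y \<le> \<tau>"]) auto
  qed (use assms in auto)
  have "(1 - a) ^ n - (1 - a - b) ^ n = measure ?S (?A - ?B)"
    unfolding mA[symmetric] mB[symmetric]
    by (rule S.finite_measure_Diff[symmetric, OF A B]) auto
  also have "\<dots> \<le> error_prob n T M e (\<lambda>_. g)"
    unfolding error_prob_eq[OF assms(2,3)]
  proof (rule S.finite_measure_mono)
    show "{w \<in> space ?S. \<exists>i\<in>{1..n}. fst w i \<and>
       card {j \<in> {1..n}. energy M (snd w) j < energy M (snd w) i} < T} \<in> sets ?S"
      using assms by (intro pred_sensing_law error_event_measurable) auto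
    show "?A - ?B \<subseteq> {w \<in> space ?S. \<exists>i\<in>{1..n}. fst w i \<and>
       card {j \<in> {1..n}. energy M (snd w) j < energy M (snd w) i} < T}"
    proof
      fix w assume w: "w \<in> ?A - ?B"
      \<comment> \<open>A channel of least energy has no channel strictly below it, so it is
        detected for every \<open>T \<ge> 1\<close>; being quiet, it cannot be a hole.\<close>
      have "{1..n} \<noteq> {}"
        using assms by simp
      then obtain i where i: "i \<in> {1..n}"
        and min: "\<And>j. j \<in> {1..n} \<Longrightarrow> energy M (snd w) i \<le> energy M (snd w) j"
        using ex_min_if_finite[of "energy M (snd w) ` {1..n}"] by (force simp: not_less)
      from w obtain k where k: "k \<in> {1..n}" "energy M (snd w) k \<le> \<tau>"
        by auto
      have "energy M (snd w) i \<le> \<tau>"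
        using min[OF k(1)] k(2) by simp
      then have "fst w i"
        using w i by auto
      moreover have "{j \<in> {1..n}. energy M (snd w) j < energy M (snd w) i} = {}"
        using min by (force simp: not_less)
      then have "card {j \<in> {1..n}. energy M (snd w) j < energy M (snd w) i} < T"
        by (simp only: card.empty) (use assms(2) in simp)
      ultimately show "w \<in> {w \<in> space ?S. \<exists>i\<in>{1..n}. fst w i \<and>
         card {j \<in> {1..n}. energy M (snd w) j < energy M (snd w) i} < T}"
        using w i by auto
    qed
  qed
  finally show ?thesis .
qed

subsection \<open>Asymptotics\<close>

lemma error_prob_le_1:
  assumes "\<And>i. i \<in> {1..n} \<Longrightarrow> p i > 0"
  shows "error_prob n T M e p \<le> 1"
proof -
  interpret prob_space "sensing_law n M e p"
    by (rule prob_space_sensing_law[OF assms])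
  show ?thesis
    unfolding error_prob_def by (rule prob_le_1)
qed

lemma error_prob_le_P_NA:
  assumes "g > 0"
  shows "error_prob n T M e (\<lambda>_. g) \<le> P_NA n T M e g"
  unfolding P_NA_def
proof (rule cSUP_upper)
  show "bdd_above (error_prob n T M e ` {p. \<forall>i\<in>{1..n}. g \<le> p i})"
    using assms by (intro bdd_aboveI2[where M = 1] error_prob_le_1) force
qed simp

lemma one_minus_power_le_exp:
  fixes x :: real
  assumes "x \<le> 1"
  shows "(1 - x) ^ n \<le> exp (- (real n * x))"
proof -
  have "(1 - x) ^ n \<le> exp (- x) ^ n"
    using assms exp_ge_add_one_self[of "- x"] by (intro power_mono) auto
  then show ?thesis
    by (simp add: exp_of_nat_mult[symmetric])
qed

text \<open>The threshold is parametrised by \<open>s\<close>, with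
  \<open>n * \<tau> ^ M = s\<close>. The right side does not depend on the powers, so it bounds the
  supremum.\<close>

lemma P_NA_le:
  assumes "1 \<le> T" and "T \<le> n" and "M \<ge> 1" and "0 < e" and "e < 1" and "g > 0"
    and "0 \<le> s" and "s \<le> real n"
  shows "P_NA n T M e g
    \<le> 2 ^ T * exp (- ((2 / (pi * exp 1 * real M)) ^ M / 2 * (e * s))) + 2 ^ M * (s / g ^ M)"
  unfolding P_NA_def
proof (rule cSUP_least)
  show "{p :: nat \<Rightarrow> real. \<forall>i\<in>{1..n}. g \<le> p i} \<noteq> {}"
    by auto
next
  fix p :: "nat \<Rightarrow> real"
  assume p: "p \<in> {p. \<forall>i\<in>{1..n}. g \<le> p i}"
  let ?c = "2 / (pi * exp 1 * real M)"
  define \<tau> where "\<tau> = root M (s / real n)"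
  let ?F = "measure (energy_law M 1) {..\<tau>}"
  interpret E: prob_space "energy_law M 1"
    by (rule prob_space_energy_law) simp
  have \<tau>0: "\<tau> \<ge> 0" and \<tau>M: "\<tau> ^ M = s / real n"
    using assms by (auto simp: \<tau>_def)
  \<comment> \<open>This is where \<open>s \<le> real n\<close> enters: the lower bound on
    \<open>?F\<close> requires \<open>\<tau>\<close> to be at most the variance 1 of a hole.\<close>
  have "\<tau> \<le> 1"
    unfolding \<tau>_def using assms by (intro real_root_le_1_iff[THEN iffD2]) auto
  then have "(?c * \<tau> / 1) ^ M \<le> ?F"
    using \<tau>0 assms by (intro energy_law_atMost_ge) auto
  then have "?c ^ M * (s / real n) \<le> ?F"
    by (simp only: div_by_1 power_mult_distrib \<tau>M)
  then have "e * (?c ^ M * (s / real n)) / 2 * real n \<le> e * ?F / 2 * real n"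
    using assms by (intro mult_right_mono divide_right_mono mult_left_mono) auto
  then have eF: "?c ^ M / 2 * (e * s) \<le> real n * (e * ?F / 2)"
    using assms by (simp add: field_simps)
  have "e * ?F \<le> 1"
    using assms by (intro mult_le_one) auto
  then have "(1 - e * ?F / 2) ^ n \<le> exp (- (real n * (e * ?F / 2)))"
    by (intro one_minus_power_le_exp) simp
  also have "\<dots> \<le> exp (- (?c ^ M / 2 * (e * s)))"
    using eF by simp
  finally have exp: "(1 - e * ?F / 2) ^ n \<le> exp (- (?c ^ M / 2 * (e * s)))" .
  have "error_prob n T M e p \<le> 2 ^ T * (1 - e * ?F / 2) ^ n + real n * (2 * \<tau> / g) ^ M"
    using p assms \<tau>0 by (intro error_prob_le) auto
  also have "real n * (2 * \<tau> / g) ^ M = 2 ^ M * (s / g ^ M)"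
    using assms by (simp add: power_divide power_mult_distrib \<tau>M)
  finally show "error_prob n T M e p \<le> 2 ^ T * exp (- (?c ^ M / 2 * (e * s))) + 2 ^ M * (s / g ^ M)"
    using exp by (smt (verit) mult_left_mono zero_le_power)
qed

text \<open>With \<open>n * e * \<tau> ^ M = 1\<close> the expected number of quiet holes is at most
  \<open>2 ^ M\<close>, while that of quiet occupied channels is at least the constant in the
  exponential. The latter depends only on \<open>M\<close> and \<open>K\<close>, so the whole bound
  has a positive limit.\<close>

lemma P_NA_ge:
  assumes "1 \<le> T" and "T \<le> n" and "M \<ge> 1" and e: "0 < e" "e \<le> 1 / 2" and "g > 0"
    and "1 \<le> real n * e" and K: "g ^ M * e \<le> K" and n: "2 ^ M \<le> n"
  shows "(1 - 2 ^ M / real n) ^ n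
      * (1 - exp (- ((2 / (pi * exp 1 * real M)) ^ M / (2 ^ (M + 1) * (1 + K))))) \<le> P_NA n T M e g"
proof -
  let ?c = "2 / (pi * exp 1 * real M)"
  let ?\<beta> = "?c ^ M / (2 ^ (M + 1) * (1 + K))"
  define \<tau> where "\<tau> = root M (1 / (real n * e))"
  let ?F = "measure (energy_law M 1) {..\<tau>}"
  let ?G = "measure (energy_law M (1 + g)) {..\<tau>}"
  let ?a = "e * ?F"
  let ?b = "(1 - e) * ?G"
  interpret E: prob_space "energy_law M 1"
    by (rule prob_space_energy_law) simp
  interpret Eg: prob_space "energy_law M (1 + g)"
    using assms by (intro prob_space_energy_law) simp
  have n0: "real n > 0"
    using assms by simp
  have K0: "K > 0"
    using K assms by (intro less_le_trans[OF _ K]) simp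
  have \<tau>0: "\<tau> \<ge> 0" and \<tau>M: "\<tau> ^ M = 1 / (real n * e)"
    using assms by (auto simp: \<tau>_def)
  have \<tau>1: "\<tau> \<le> 1"
    unfolding \<tau>_def using assms by (intro real_root_le_1_iff[THEN iffD2]) auto
  have "?F \<le> (2 * \<tau> / 1) ^ M"
    using \<tau>0 by (intro energy_law_atMost_le) auto
  also have "\<dots> = 2 ^ M / (real n * e)"
    by (simp add: power_mult_distrib \<tau>M)
  finally have "?a \<le> e * (2 ^ M / (real n * e))"
    using e by (intro mult_left_mono) auto
  then have a: "?a \<le> 2 ^ M / real n"
    using e by simp
  \<comment> \<open>Passing through \<open>max 1 g\<close> bounds \<open>(1 + g) ^ M\<close> by a
    multiple of \<open>1 + g ^ M\<close>, so that the hypothesis on \<open>g ^ M * e\<close> applies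
    to the true variance \<open>1 + g\<close>.\<close>
  have "(1 + g) ^ M \<le> (2 * max 1 g) ^ M"
    using assms by (intro power_mono) auto
  also have "\<dots> = 2 ^ M * max 1 g ^ M"
    by (simp add: power_mult_distrib)
  also have "max 1 g ^ M \<le> 1 + g ^ M"
    using assms by (auto simp: max_def)
  finally have "e * (1 + g) ^ M \<le> e * (2 ^ M * (1 + g ^ M))"
    using e by (intro mult_left_mono) auto
  also have "\<dots> = 2 ^ M * (e + g ^ M * e)"
    by (simp add: algebra_simps)
  also have "\<dots> \<le> 2 ^ M * (1 + K)"
    using e K by (intro mult_left_mono) auto
  finally have eg: "e * (1 + g) ^ M \<le> 2 ^ M * (1 + K)" .
  \<comment> \<open>One factor 2 is split off \<open>2 ^ (M + 1)\<close>, because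
    \<open>1 - e\<close> is only known to be at least \<open>1 / 2\<close>.\<close>
  have "?\<beta> = 1 / 2 * (?c ^ M / (2 ^ M * (1 + K)))"
    by simp
  also have "\<dots> \<le> 1 / 2 * (?c ^ M / (e * (1 + g) ^ M))"
    using e assms eg K0 by (intro mult_left_mono divide_left_mono mult_pos_pos) auto
  also have "\<dots> = 1 / 2 * (real n * (?c * \<tau> / (1 + g)) ^ M)"
    using n0 by (simp add: power_divide power_mult_distrib \<tau>M)
  also have "\<dots> \<le> (1 - e) * (real n * ?G)"
    using e assms \<tau>0 \<tau>1 by (intro mult_mono mult_left_mono energy_law_atMost_ge) auto
  finally have b: "?\<beta> \<le> real n * ?b"
    by (simp add: mult_ac)
  have a0: "0 \<le> ?a" and b0: "0 \<le> ?b"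
    using e by auto
  have ae: "?a \<le> e"
    using e by (intro mult_left_le) auto
  have be: "?b \<le> 1 - e"
    using e by (intro mult_left_le) auto
  \<comment> \<open>Adding the nonnegative \<open>?a * ?b\<close> separates the two probabilities,
    so that \<open>(1 - ?a) ^ n\<close> can be factored out of the difference.\<close>
  have "(1 - ?a - ?b) ^ n \<le> ((1 - ?a) * (1 - ?b)) ^ n"
    using ae be mult_nonneg_nonneg[OF a0 b0] by (intro power_mono) (simp_all add: algebra_simps)
  also have "\<dots> = (1 - ?a) ^ n * (1 - ?b) ^ n"
    by (rule power_mult_distrib)
  also have "\<dots> \<le> (1 - ?a) ^ n * exp (- ?\<beta>)"
  proof (intro mult_left_mono)
    have "(1 - ?b) ^ n \<le> exp (- (real n * ?b))"
      by (intro one_minus_power_le_exp order_trans[OF be]) (use e in simp)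
    also have "\<dots> \<le> exp (- ?\<beta>)"
      using b by simp
    finally show "(1 - ?b) ^ n \<le> exp (- ?\<beta>)" .
    show "0 \<le> (1 - ?a) ^ n"
      by (rule zero_le_power) (use ae e in linarith)
  qed
  finally have "(1 - ?a) ^ n * (1 - exp (- ?\<beta>)) \<le> (1 - ?a) ^ n - (1 - ?a - ?b) ^ n"
    by (simp add: algebra_simps)
  moreover have "(1 - 2 ^ M / real n) ^ n * (1 - exp (- ?\<beta>)) \<le> (1 - ?a) ^ n * (1 - exp (- ?\<beta>))"
  proof (intro mult_right_mono power_mono)
    have "real (2 ^ M) \<le> real n"
      using n by (simp only: of_nat_le_iff)
    then show "0 \<le> 1 - 2 ^ M / real n"
      using n0 by simp
  qed (use a K0 in auto)
  moreover have "(1 - ?a) ^ n - (1 - ?a - ?b) ^ n \<le> error_prob n T M e (\<lambda>_. g)"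
    using assms by (intro error_prob_ge) auto
  moreover have "error_prob n T M e (\<lambda>_. g) \<le> P_NA n T M e g"
    by (rule error_prob_le_P_NA[OF assms(6)])
  ultimately show ?thesis
    by linarith
qed

text \<open>All quantities are eventually positive, so the comparison can be raised to the power
  \<open>M\<close>; the constants \<open>c\<close> and \<open>c ^ M\<close> range over the same
  positive reals. The finite-size bounds involve exactly the product
  \<open>gam n ^ M * eps n\<close>.\<close>

lemma smallomega_root_iff:
  fixes eps gam :: "nat \<Rightarrow> real"
  assumes "M \<ge> 1" and pos: "eventually (\<lambda>n. 0 < eps n \<and> 0 < gam n) sequentially"
  shows "gam \<in> \<omega>(\<lambda>n. root M (1 / eps n))
    \<longleftrightarrow> filterlim (\<lambda>n. gam n ^ M * eps n) at_top sequentially"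
proof
  assume *: "gam \<in> \<omega>(\<lambda>n. root M (1 / eps n))"
  show "filterlim (\<lambda>n. gam n ^ M * eps n) at_top sequentially"
    unfolding filterlim_at_top_gt[where c = 0]
  proof (intro allI impI)
    fix Z :: real assume Z: "Z > 0"
    then have "root M Z > 0"
      using assms by simp
    from landau_omega.smallD[OF * this] pos
    show "eventually (\<lambda>n. Z \<le> gam n ^ M * eps n) sequentially"
    proof eventually_elim
      case (elim n)
      then have "root M Z * root M (1 / eps n) \<le> gam n"
        using assms by (simp add: real_root_gt_zero)
      then have "(root M Z * root M (1 / eps n)) ^ M \<le> gam n ^ M"
        using elim Z assms by (intro power_mono) auto
      then show ?case
        using elim Z assms by (simp add: power_mult_distrib field_simps)
    qed
  qed
next
  assume *: "filterlim (\<lambda>n. gam n ^ M * eps n) at_top sequentially"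
  show "gam \<in> \<omega>(\<lambda>n. root M (1 / eps n))"
  proof (rule landau_omega.smallI)
    fix c :: real assume c: "c > 0"
    have "eventually (\<lambda>n. c ^ M \<le> gam n ^ M * eps n) sequentially"
      using * by (simp add: filterlim_at_top)
    with pos show "eventually (\<lambda>n. norm (gam n) \<ge> c * norm (root M (1 / eps n))) sequentially"
    proof eventually_elim
      case (elim n)
      then have "(c * root M (1 / eps n)) ^ M \<le> gam n ^ M"
        using c assms by (simp add: power_mult_distrib field_simps)
      then have "c * root M (1 / eps n) \<le> gam n"
        using elim c assms by (subst (asm) power_mono_iff) auto
      then show ?case
        using elim c assms by simp
    qed
  qed
qed

theorem corollary1:
  fixes T M :: nat and eps gam :: "nat \<Rightarrow> real"
  assumes "T \<ge> 1" and "M \<ge> 1"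
    and "\<And>n. n \<ge> 1 \<Longrightarrow> 0 < eps n \<and> eps n < 1"
    and "\<And>n. n \<ge> 1 \<Longrightarrow> 0 < gam n"
    and "eps \<in> o(\<lambda>_. 1)"
    and "(\<lambda>n. real n * eps n) \<in> \<omega>(\<lambda>_. 1)"
  shows "(\<lambda>n. P_NA n T M (eps n) (gam n)) \<longlonglongrightarrow> 0 \<longleftrightarrow>
         gam \<in> \<omega>(\<lambda>n. root M (1 / eps n))"
proof -
  let ?c = "2 / (pi * exp 1 * real M)"
  have c: "?c ^ M > 0"
    using assms by simp
  have pos: "eventually (\<lambda>n. 0 < eps n \<and> 0 < gam n) sequentially"
    using eventually_ge_at_top[of 1] by eventually_elim (use assms in auto)
  have neps: "filterlim (\<lambda>n. real n * eps n) at_top sequentially"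
    unfolding filterlim_at_top_gt[where c = 0]
  proof (intro allI impI)
    fix Z :: real assume "Z > 0"
    from landau_omega.smallD[OF assms(6) this] pos
    show "eventually (\<lambda>n. Z \<le> real n * eps n) sequentially"
      by eventually_elim auto
  qed
  have eps0: "eps \<longlonglongrightarrow> 0"
    using smalloD_tendsto[OF assms(5)] by simp
  show ?thesis
    unfolding smallomega_root_iff[OF assms(2) pos]
  proof
    assume P: "(\<lambda>n. P_NA n T M (eps n) (gam n)) \<longlonglongrightarrow> 0"
    show "filterlim (\<lambda>n. gam n ^ M * eps n) at_top sequentially"
      unfolding filterlim_at_top_gt[where c = 0]
    proof (intro allI impI)
      fix K :: real assume K: "K > 0"
      let ?\<beta> = "?c ^ M / (2 ^ (M + 1) * (1 + K))"
      let ?L = "\<lambda>n. (1 - 2 ^ M / real n) ^ n * (1 - exp (- ?\<beta>))"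
      have "(\<lambda>n. (1 + (- (2 ^ M)) / real n) ^ n) \<longlonglongrightarrow> exp (- (2 ^ M))"
        by (rule tendsto_exp_limit_sequentially)
      then have "(\<lambda>n. (1 - 2 ^ M / real n) ^ n * (1 - exp (- ?\<beta>)))
          \<longlonglongrightarrow> exp (- (2 ^ M)) * (1 - exp (- ?\<beta>))"
        by (intro tendsto_mult_right) simp
      then have "(\<lambda>n. ?L n - P_NA n T M (eps n) (gam n))
          \<longlonglongrightarrow> exp (- (2 ^ M)) * (1 - exp (- ?\<beta>)) - 0"
        using P by (rule tendsto_diff)
      moreover have "exp (- (2 ^ M)) * (1 - exp (- ?\<beta>)) - 0 > 0"
        using c K by simp
      \<comment> \<open>Eventually \<open>P_NA\<close> lies below the bound of
        \<open>P_NA_ge\<close>. The other hypotheses of that lemma hold for large \<open>n\<close>,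
        so its hypothesis \<open>g ^ M * e \<le> K\<close> must fail, which is the claim.\<close>
      ultimately have "eventually (\<lambda>n. ?L n - P_NA n T M (eps n) (gam n) > 0) sequentially"
        by (rule order_tendstoD)
      moreover have "eventually (\<lambda>n. eps n < 1 / 2) sequentially"
        using eps0 by (rule order_tendstoD) simp
      moreover have "eventually (\<lambda>n. 1 \<le> real n * eps n) sequentially"
        using neps by (simp add: filterlim_at_top)
      ultimately show "eventually (\<lambda>n. K \<le> gam n ^ M * eps n) sequentially"
        using pos eventually_ge_at_top[of T] eventually_ge_at_top[of "2 ^ M"]
      proof eventually_elim
        case (elim n)
        then show ?case
          using P_NA_ge[of T n M "eps n" "gam n" K] assms(1,2) by fastforce
      qed
    qed
  next
    assume g: "filterlim (\<lambda>n. gam n ^ M * eps n) at_top sequentially"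
    \<comment> \<open>\<open>s\<close> must be large against \<open>1 / eps n\<close> and small
      against \<open>gam n ^ M\<close>; the square root is the geometric mean of the two. The cap
      \<open>real n\<close> keeps the threshold at most 1 and does no harm, since
      \<open>real n * eps n\<close> tends to infinity.\<close>
    define s where "s n = min (real n) (sqrt (gam n ^ M / eps n))" for n
    have sqrt_g: "filterlim (\<lambda>n. sqrt (gam n ^ M * eps n)) at_top sequentially"
      by (rule filterlim_compose[OF sqrt_at_top g])
    have "filterlim (\<lambda>n. eps n * s n) at_top sequentially"
      unfolding filterlim_at_top
    proof
      fix Z :: real
      have "eventually (\<lambda>n. Z \<le> real n * eps n) sequentially"
        "eventually (\<lambda>n. Z \<le> sqrt (gam n ^ M * eps n)) sequentially"
        using neps sqrt_g by (simp_all add: filterlim_at_top)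
      then show "eventually (\<lambda>n. Z \<le> eps n * s n) sequentially"
        using pos
      proof eventually_elim
        case (elim n)
        have "eps n * sqrt (gam n ^ M / eps n) = sqrt (gam n ^ M * eps n)"
          using elim by (simp add: real_sqrt_divide real_sqrt_mult real_div_sqrt field_simps)
        with elim show ?case
          by (simp add: s_def min_def mult.commute)
      qed
    qed
    then have "filterlim (\<lambda>n. ?c ^ M / 2 * (eps n * s n)) at_top sequentially"
      by (rule filterlim_tendsto_pos_mult_at_top[OF tendsto_const, rotated]) (use c in simp)
    then have "filterlim (\<lambda>n. - (?c ^ M / 2 * (eps n * s n))) at_bot sequentially"
      by (simp only: filterlim_uminus_at_top)
    then have "(\<lambda>n. exp (- (?c ^ M / 2 * (eps n * s n)))) \<longlonglongrightarrow> 0"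
      by (rule filterlim_compose[OF exp_at_bot])
    moreover have "(\<lambda>n. s n / gam n ^ M) \<longlonglongrightarrow> 0"
    proof (rule tendsto_sandwich[OF _ _ tendsto_const])
      show "(\<lambda>n. inverse (sqrt (gam n ^ M * eps n))) \<longlonglongrightarrow> 0"
        by (rule tendsto_inverse_0_at_top[OF sqrt_g])
      show "eventually (\<lambda>n. 0 \<le> s n / gam n ^ M) sequentially"
        using pos by eventually_elim (auto simp: s_def)
      show "eventually (\<lambda>n. s n / gam n ^ M \<le> inverse (sqrt (gam n ^ M * eps n))) sequentially"
        using pos
      proof eventually_elim
        case (elim n)
        \<comment> \<open>Only the upper bound of \<open>s n\<close> by the square root is needed;
          \<open>gam n ^ M\<close> is written as a square so that one root cancels.\<close>
        then have "s n / gam n ^ M \<le> sqrt (gam n ^ M / eps n) / (sqrt (gam n ^ M) * sqrt (gam n ^ M))"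
          by (simp add: s_def divide_right_mono)
        also have "\<dots> = inverse (sqrt (gam n ^ M * eps n))"
          using elim by (simp add: real_sqrt_divide real_sqrt_mult field_simps)
        finally show ?case .
      qed
    qed
    ultimately have "(\<lambda>n. 2 ^ T * exp (- (?c ^ M / 2 * (eps n * s n))) + 2 ^ M * (s n / gam n ^ M))
        \<longlonglongrightarrow> 2 ^ T * 0 + 2 ^ M * 0"
      by (intro tendsto_add tendsto_mult tendsto_const)
    then have lim: "(\<lambda>n. 2 ^ T * exp (- (?c ^ M / 2 * (eps n * s n))) + 2 ^ M * (s n / gam n ^ M))
        \<longlonglongrightarrow> 0"
      by simp
    show "(\<lambda>n. P_NA n T M (eps n) (gam n)) \<longlonglongrightarrow> 0"
    proof (rule tendsto_sandwich[OF _ _ tendsto_const lim])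
      show "eventually (\<lambda>n. 0 \<le> P_NA n T M (eps n) (gam n)) sequentially"
        using pos
      proof eventually_elim
        case (elim n)
        have "0 \<le> error_prob n T M (eps n) (\<lambda>_. gam n)"
          by (simp add: error_prob_def)
        also have "\<dots> \<le> P_NA n T M (eps n) (gam n)"
          using elim by (intro error_prob_le_P_NA) simp
        finally show ?case .
      qed
      show "eventually (\<lambda>n. P_NA n T M (eps n) (gam n)
          \<le> 2 ^ T * exp (- (?c ^ M / 2 * (eps n * s n))) + 2 ^ M * (s n / gam n ^ M)) sequentially"
        using eventually_ge_at_top[of T]
      proof eventually_elim
        case (elim n)
        then have "n \<ge> 1"
          using assms(1) by simp
        with assms(3,4)[of n] elim assms(1,2) show ?case
          by (intro P_NA_le) (auto simp: s_def)
      qed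
    qed
  qed
qed

end
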